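(* Consider the two-dimensional rezoning moving-mesh (RMM) scheme described in the context, which alternates an SSPRK3 finite-volume evolution on a fixed mesh, an arbitrary rezoning of the mesh, and an SSPRK3 advection-based remapping with evolved geometric moments, all using a 2-exact reconstruction. The scheme satisfies the TPE(2) property for any physical time step sizes $\Delta t$ and any pseudo-time step sizes $\Delta\tau$. That is: if the hyperbolic system is the linear advection system $\partial_t\mathbf U+\nabla\cdot(\mathbf U\otimes\mathbf a)=\mathbf 0$ with constant $\mathbf a=(a_x,a_y)\in\mathbb R^2$ and $\mathbf U\in\mathbb R^m$, if the initial condition $\mathbf U_0:\mathbb R^2\to\mathbb R^m$ is a polynomial of total degree at most $2$, and if the scheme is initialized with the exact cell averages of $\mathbf U_0$ on the initial mesh, then at every discrete time $t^n$ and for every cell $I^n_{i,j}$ of the mesh at $t^n$, $$\overline{\mathbf U}^n_{i,j}=\frac1{|I^n_{i,j}|}\int_{I^n_{i,j}}\mathbf U_0(\mathbf x-\mathbf a t^n)\,\mathrm d\mathbf x ,$$ for every sequence of physical time steps $\Delta t$, every choice of pseudo-time steps $\Delta\tau$, and every sequence of rezoned meshes (satisfying the mesh regularity assumption).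
   Context: Meshes. At time $t^n$ the mesh $\mathcal T_h^n=\{I^n_{i,j}\}_{1\le i\le N_x,1\le j\le N_y}$ is a logically rectangular conforming mesh of quadrilaterals (neighbouring cells share a full edge and its vertices); $\mathcal T^0_h$ is a uniform rectangular mesh. For a cell with counterclockwise vertices $A,B,C,D$ the edges are $l^1=AB,l^2=BC,l^3=CD,l^4=DA$, with lengths $|l^k|$ and outward unit normals $\mathbf n_k$. Three-point Gauss--Lobatto quadrature on an edge: points $\mathbf x_{k,g}=(x_{k,g},y_{k,g})$, $g=1,2,3$, are the first endpoint, midpoint, second endpoint, with weights $\omega_1=\omega_3=\frac16,\ \omega_2=\frac23$. Exact moments: $\mathcal M_{s,r,i,j}=\int_{I_{i,j}}x^sy^r\,\mathrm dx\,\mathrm dy$. The scheme also carries evolved geometric moments (EGMs) $\widetilde{\mathcal M}_{s,r,i,j}$, $s+r\le2$, initialized on $\mathcal T_h^0$ by the exact moments. Reconstruction. Given a mesh, EGMs and cell averages $\overline{\mathbf U}_{i,j}\in\mathbb R^m$, the reconstruction assigns to each cell a function $\mathbf U_h:\mathbb R^2\to\mathbb R^m$ depending on the averages and EGMs in a stencil of that cell. It is 2-exact for the given mesh and EGMs if, whenever the averages on the stencil are generated by a polynomial $\mathbf p(x,y)=\sum_{s+r\le2}\mathbf c_{s,r}x^sy^r$, $\mathbf c_{s,r}\in\mathbb R^m$, i.e. $\overline{\mathbf U}_{i,j}=\widetilde{\mathcal M}_{0,0,i,j}^{-1}\sum_{s+r\le2}\mathbf c_{s,r}\widetilde{\mathcal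 M}_{s,r,i,j}$ on the stencil, one has $\mathbf U_h(x,y)=\mathbf p(x,y)$ at every point. The reconstruction used is assumed 2-exact at every stage of the scheme. $\mathbf U^{\mathrm{int}}_{k,g}$ and $\mathbf U^{\mathrm{ext}}_{k,g}$ are the values at $\mathbf x_{k,g}$ of the reconstructions in the cell itself and in the neighbour across $l^k$. On boundary edges the exterior state is given by exact boundary data: whenever there is one polynomial $\mathbf p(x,y)=\sum_{s+r\le2}\mathbf c_{s,r}x^sy^r$, $\mathbf c_{s,r}\in\mathbb R^m$, such that $\overline{\mathbf U}_{i,j}=\widetilde{\mathcal M}_{0,0,i,j}^{-1}\sum_{s+r\le2}\mathbf c_{s,r}\widetilde{\mathcal M}_{s,r,i,j}$ for all cells of the mesh, $\mathbf U^{\mathrm{ext}}_{k,g}=\mathbf p(\mathbf x_{k,g})$. Step 1 (physical evolution, from $t^n$ to $t^{n+1}=t^n+\Delta t$ on the fixed mesh $\mathcal T_h^n$). With $\mathbf F(\mathbf U)=\mathbf U\otimes\mathbf a$, $$\mathcal L^{\overline{\mathbf U}}_{i,j}(\overline{\mathbf U})=-\frac1{\widetilde{\mathcal M}_{0,0,i,j}}\sum_{k=1}^4|l^k|\sum_{g=1}^3\omega_g\tfrac12\bigl[\mathbf F(\mathbf U^{\mathrm{int}}_{k,g})\cdot\mathbf n_k+\mathbf F(\mathbf U^{\mathrm{ext}}_{k,g})\cdot\mathbf n_k-\tilde a^{\max}_{i,j,k}(\mathbf U^{\mathrm{ext}}_{k,g}-\mathbf U^{\mathrm{int}}_{k,g})\bigr],$$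 where $\tilde a^{\max}_{i,j,k}=|\mathbf a\cdot\mathbf n_k|$, and one SSPRK3 step is taken: $\overline{\mathbf U}^{(1)}=\overline{\mathbf U}^n+\Delta t\,\mathcal L(\overline{\mathbf U}^n)$, $\overline{\mathbf U}^{(2)}=\frac34\overline{\mathbf U}^n+\frac14(\overline{\mathbf U}^{(1)}+\Delta t\,\mathcal L(\overline{\mathbf U}^{(1)}))$, $\overline{\mathbf U}^{n+1,0}=\frac13\overline{\mathbf U}^n+\frac23(\overline{\mathbf U}^{(2)}+\Delta t\,\mathcal L(\overline{\mathbf U}^{(2)}))$. Step 2 (rezoning). A new mesh $\mathcal T_h^{n+1}$ with the same connectivity is chosen arbitrarily. Vertices move as $\mathbf x_P(\tau)=\mathbf x_P^n+\tau\mathbf w_P$, $\mathbf w_P=(\mathbf x_P^{n+1}-\mathbf x_P^n)/\tau^{\mathrm{final}}$, $\tau\in[0,\tau^{\mathrm{final}}]$, defining cells $I_{i,j}(\tau)$. Mesh regularity assumption: for every $\tau$ the four vertices of each $I_{i,j}(\tau)$ are pairwise distinct and strictly counterclockwise ordered, and $I_{i,j}(\tau)$ is a (nondegenerate) convex quadrilateral. Step 3 (remapping). Set $\mathbf V^0_{i,j}=\overline{\mathbf U}^{n+1,0}_{i,j}\widetilde{\mathcal M}^0_{0,0,i,j}$, with $\widetilde{\mathcal M}^0$ inherited from the previous step. With $\mathbf w_{k,g}$ the linear interpolation along the edge of the endpoint velocities, define $$\mathcal L^{\widetilde{\mathcal M}_{s,r}}_{i,j}(I_{i,j})=\sum_{k=1}^4|l^k|\sum_{g=1}^3\omega_g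 x_{k,g}^sy_{k,g}^r(\mathbf w_{k,g}\cdot\mathbf n_k),$$ $$\mathcal L^{\mathbf V}_{i,j}(\widetilde{\mathcal M},\mathbf V,I_{i,j})=-\sum_{k=1}^4|l^k|\sum_{g=1}^3\omega_g\tfrac12\bigl[\mathbf G(\mathbf U^{\mathrm{int}}_{k,g},\mathbf w_{k,g})\cdot\mathbf n_k+\mathbf G(\mathbf U^{\mathrm{ext}}_{k,g},\mathbf w_{k,g})\cdot\mathbf n_k-a^{\max}_{i,j,k}(\mathbf U^{\mathrm{ext}}_{k,g}-\mathbf U^{\mathrm{int}}_{k,g})\bigr],$$ where $\mathbf G(\mathbf U,\mathbf w)=-\mathbf U\otimes\mathbf w$, $a^{\max}_{i,j,k}=\max_g|\mathbf w_{k,g}\cdot\mathbf n_k|$, and the point values are reconstructed from $\overline{\mathbf U}_{i,j}=\mathbf V_{i,j}/\widetilde{\mathcal M}_{0,0,i,j}$ and the EGMs ($\widetilde{\mathcal M}_{0,0,i,j}\neq0$ at all stages, so that averages are defined). Both $\widetilde{\mathcal M}_{s,r,i,j}$ and $\mathbf V_{i,j}$ are advanced from $\tau^0=0$ to $\tau^{N_\ell}=\tau^{\mathrm{final}}$ by SSPRK3 steps $\tau^{\ell+1}=\tau^\ell+\Delta\tau$: $(\cdot)^{(1)}=(\cdot)^\ell+\Delta\tau\mathcal L(\widetilde{\mathcal M}^\ell,\mathbf V^\ell,I^\ell)$; $(\cdot)^{(2)}=\frac34(\cdot)^\ell+\frac14[(\cdot)^{(1)}+\Delta\tau\mathcal L(\widetilde{\mathcal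 M}^{(1)},\mathbf V^{(1)},I^{(1)})]$; $(\cdot)^{\ell+1}=\frac13(\cdot)^\ell+\frac23[(\cdot)^{(2)}+\Delta\tau\mathcal L(\widetilde{\mathcal M}^{(2)},\mathbf V^{(2)},I^{(2)})]$, with $I^\ell=I(\tau^\ell)$, $I^{(1)}=I(\tau^\ell+\Delta\tau)$, $I^{(2)}=I(\tau^\ell+\frac12\Delta\tau)$. Finally $\overline{\mathbf U}^{n+1}_{i,j}=\mathbf V^{N_\ell}_{i,j}/\widetilde{\mathcal M}^{N_\ell}_{0,0,i,j}$, and the EGMs at $\tau^{N_\ell}$ are passed on. Optionally, Steps 2--3 are repeated a finite number of times within one time step, starting from the latest mesh, averages and EGMs. TPE(2) (transport polynomial exactness of order 2): whenever the system reduces to constant-coefficient linear advection with an initial condition that is a vector polynomial of degree at most 2, the fully discrete solution (the cell averages) equals the cell averages of the exact solution $\mathbf U_0(\mathbf x-\mathbf at)$ at all discrete times. *)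

theory Defs
  imports "HOL-Analysis.Analysis"
begin

section \<open>Logically rectangular quadrilateral meshes\<close>

text \<open>
  A mesh with \<open>Nx\<close> times \<open>Ny\<close> cells is given by its vertex positions, indexed by \<open>(i, j)\<close>
  with \<open>i \<le> Nx\<close> and \<open>j \<le> Ny\<close>; cells are indexed by \<open>(i, j)\<close> with \<open>1 \<le> i \<le> Nx\<close> and
  \<open>1 \<le> j \<le> Ny\<close>. Neighbouring cells share vertices, hence full edges, by construction, and
  all meshes with the same \<open>Nx\<close>, \<open>Ny\<close> have the same connectivity. Values of mesh functions and
  of cell-indexed functions outside these index ranges are junk.
\<close>

type_synonym cell_idx = "nat \<times> nat"
type_synonym mesh = "nat \<times> nat \<Rightarrow> real^2"

definition cells :: "nat \<Rightarrow> nat \<Rightarrow> cell_idx set" where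
  "cells Nx Ny = {1..Nx} \<times> {1..Ny}"

text \<open>The vertices \<open>A, B, C, D\<close> of a cell are its corners 1, 2, 3, 4, and corner 5 is \<open>A\<close> again,
  so the edge \<open>k\<close> runs from corner \<open>k\<close> to corner \<open>k + 1\<close> for \<open>k = 1, \<dots>, 4\<close>.
  The function is also applied to vertex velocity fields.\<close>

definition corner :: "(nat \<times> nat \<Rightarrow> real^2) \<Rightarrow> cell_idx \<Rightarrow> nat \<Rightarrow> real^2" where
  "corner X K k = (case K of (i, j) \<Rightarrow>
     if k = 2 then X (i, j - 1)
     else if k = 3 then X (i, j)
     else if k = 4 then X (i - 1, j)
     else X (i - 1, j - 1))"

text \<open>The index of the cell across edge \<open>k\<close>; edge \<open>k\<close> of \<open>K \<in> cells Nx Ny\<close> is a boundary edge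
  iff this index is not in \<open>cells Nx Ny\<close>.\<close>

definition neighbour :: "cell_idx \<Rightarrow> nat \<Rightarrow> cell_idx" where
  "neighbour K k = (case K of (i, j) \<Rightarrow>
     if k = 1 then (i, j - 1)
     else if k = 2 then (i + 1, j)
     else if k = 3 then (i, j + 1)
     else (i - 1, j))"

definition cell_region :: "mesh \<Rightarrow> cell_idx \<Rightarrow> (real^2) set" where
  "cell_region X K = convex hull {corner X K 1, corner X K 2, corner X K 3, corner X K 4}"

definition uniform_rectangular :: "nat \<Rightarrow> nat \<Rightarrow> mesh \<Rightarrow> bool" where
  "uniform_rectangular Nx Ny X \<longleftrightarrow> (\<exists>x0 y0 hx hy. hx > 0 \<and> hy > 0 \<and>
     (\<forall>i\<le>Nx. \<forall>j\<le>Ny. X (i, j) = vector [x0 + real i * hx, y0 + real j * hy]))"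

definition strictly_ccw :: "real^2 \<Rightarrow> real^2 \<Rightarrow> real^2 \<Rightarrow> bool" where
  "strictly_ccw P Q R \<longleftrightarrow>
     (Q - P) $ 1 * (R - P) $ 2 - (Q - P) $ 2 * (R - P) $ 1 > 0"

text \<open>A nondegenerate convex quadrilateral with counterclockwise vertices \<open>A, B, C, D\<close>: walking
  along the boundary one makes a strict left turn at each of the four vertices.\<close>

definition regular_cell :: "mesh \<Rightarrow> cell_idx \<Rightarrow> bool" where
  "regular_cell X K \<longleftrightarrow>
     distinct [corner X K 1, corner X K 2, corner X K 3, corner X K 4] \<and>
     strictly_ccw (corner X K 1) (corner X K 2) (corner X K 3) \<and>
     strictly_ccw (corner X K 2) (corner X K 3) (corner X K 4) \<and>
     strictly_ccw (corner X K 3) (corner X K 4) (corner X K 1) \<and>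
     strictly_ccw (corner X K 4) (corner X K 1) (corner X K 2)"

definition edge_length :: "mesh \<Rightarrow> cell_idx \<Rightarrow> nat \<Rightarrow> real" where
  "edge_length X K k = dist (corner X K k) (corner X K (k + 1))"

text \<open>The edge vector rotated clockwise by a right angle and normalized; it points outward because
  the vertices are ordered counterclockwise.\<close>

definition outward_normal :: "mesh \<Rightarrow> cell_idx \<Rightarrow> nat \<Rightarrow> real^2" where
  "outward_normal X K k = (let e = corner X K (k + 1) - corner X K k
     in (1 / norm e) *\<^sub>R vector [e $ 2, - e $ 1])"

section \<open>Gauss--Lobatto quadrature, moments, polynomials\<close>

definition gl_weight :: "nat \<Rightarrow> real" where
  "gl_weight g = (if g = 2 then 2/3 else 1/6)"

text \<open>Linear interpolation along edge \<open>k\<close>, at its first endpoint, midpoint and second endpoint for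
  \<open>g = 1, 2, 3\<close>. For a mesh \<open>X\<close> this is the quadrature point, for a vertex velocity field it is
  the interpolated velocity at that point.\<close>

definition edge_pt :: "(nat \<times> nat \<Rightarrow> real^2) \<Rightarrow> cell_idx \<Rightarrow> nat \<Rightarrow> nat \<Rightarrow> real^2" where
  "edge_pt X K k g = (let \<theta> = (real g - 1) / 2
     in (1 - \<theta>) *\<^sub>R corner X K k + \<theta> *\<^sub>R corner X K (k + 1))"

definition exact_moment :: "mesh \<Rightarrow> nat \<Rightarrow> nat \<Rightarrow> cell_idx \<Rightarrow> real" where
  "exact_moment X s r K = integral (cell_region X K) (\<lambda>z. (z $ 1) ^ s * (z $ 2) ^ r)"

definition exact_average :: "mesh \<Rightarrow> (real^2 \<Rightarrow> real^'m) \<Rightarrow> cell_idx \<Rightarrow> real^'m" where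
  "exact_average X u K =
     (1 / measure lebesgue (cell_region X K)) *\<^sub>R integral (cell_region X K) u"

definition poly2 :: "(nat \<Rightarrow> nat \<Rightarrow> real^'m) \<Rightarrow> real^2 \<Rightarrow> real^'m" where
  "poly2 c z = (\<Sum>(s, r) | s + r \<le> 2. ((z $ 1) ^ s * (z $ 2) ^ r) *\<^sub>R c s r)"

text \<open>Geometric moments \<open>M s r K\<close> are indexed by arbitrary \<open>s, r\<close>; only those with \<open>s + r \<le> 2\<close>
  are meaningful.\<close>

type_synonym egm = "nat \<Rightarrow> nat \<Rightarrow> cell_idx \<Rightarrow> real"
type_synonym 'm averages = "cell_idx \<Rightarrow> real^'m"

definition generated_average ::
    "egm \<Rightarrow> (nat \<Rightarrow> nat \<Rightarrow> real^'m) \<Rightarrow> cell_idx \<Rightarrow> real^'m" where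
  "generated_average M c K =
     (1 / M 0 0 K) *\<^sub>R (\<Sum>(s, r) | s + r \<le> 2. M s r K *\<^sub>R c s r)"

section \<open>Reconstruction and boundary data\<close>

type_synonym 'm reconstruction =
  "mesh \<Rightarrow> egm \<Rightarrow> 'm::finite averages \<Rightarrow> cell_idx \<Rightarrow> real^2 \<Rightarrow> real^'m"

definition stencil_based ::
    "nat \<Rightarrow> nat \<Rightarrow> (cell_idx \<Rightarrow> cell_idx set) \<Rightarrow> 'm::finite reconstruction \<Rightarrow> bool" where
  "stencil_based Nx Ny S R \<longleftrightarrow> (\<forall>K\<in>cells Nx Ny. S K \<subseteq> cells Nx Ny \<and>
     (\<forall>X M M' U U'.
        (\<forall>L\<in>S K. U L = U' L \<and> (\<forall>s r. s + r \<le> 2 \<longrightarrow> M s r L = M' s r L)) \<longrightarrow>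
        R X M U K = R X M' U' K))"

definition two_exact ::
    "nat \<Rightarrow> nat \<Rightarrow> (cell_idx \<Rightarrow> cell_idx set) \<Rightarrow> 'm::finite reconstruction \<Rightarrow> mesh \<Rightarrow> egm \<Rightarrow> bool" where
  "two_exact Nx Ny S R X M \<longleftrightarrow> (\<forall>K\<in>cells Nx Ny. \<forall>U c.
     (\<forall>L\<in>S K. U L = generated_average M c L) \<longrightarrow> (\<forall>z. R X M U K z = poly2 c z))"

text \<open>\<open>b K k g\<close> is the exterior state at quadrature point \<open>g\<close> of the boundary edge \<open>k\<close> of \<open>K\<close>.\<close>

type_synonym 'm boundary_data = "cell_idx \<Rightarrow> nat \<Rightarrow> nat \<Rightarrow> real^'m"

definition exact_boundary ::
    "nat \<Rightarrow> nat \<Rightarrow> mesh \<Rightarrow> egm \<Rightarrow> 'm::finite averages \<Rightarrow> 'm::finite boundary_data \<Rightarrow> bool" where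
  "exact_boundary Nx Ny X M U b \<longleftrightarrow> (\<forall>c.
     (\<forall>K\<in>cells Nx Ny. U K = generated_average M c K) \<longrightarrow>
     (\<forall>K\<in>cells Nx Ny. \<forall>k\<in>{1..4}. \<forall>g\<in>{1..3}.
        neighbour K k \<notin> cells Nx Ny \<longrightarrow> b K k g = poly2 c (edge_pt X K k g)))"

definition int_state ::
    "'m::finite reconstruction \<Rightarrow> mesh \<Rightarrow> egm \<Rightarrow> 'm::finite averages \<Rightarrow> cell_idx \<Rightarrow> nat \<Rightarrow> nat \<Rightarrow> real^'m" where
  "int_state R X M U K k g = R X M U K (edge_pt X K k g)"

definition ext_state ::
    "nat \<Rightarrow> nat \<Rightarrow> 'm::finite reconstruction \<Rightarrow> 'm::finite boundary_data \<Rightarrow> mesh \<Rightarrow> egm \<Rightarrow> 'm::finite averages \<Rightarrow>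
     cell_idx \<Rightarrow> nat \<Rightarrow> nat \<Rightarrow> real^'m" where
  "ext_state Nx Ny R b X M U K k g =
     (if neighbour K k \<in> cells Nx Ny
      then R X M U (neighbour K k) (edge_pt X K k g)
      else b K k g)"

text \<open>The standing assumptions on the data \<open>(X, M, U)\<close> of one Runge--Kutta stage: averages are
  defined, the reconstruction is 2-exact and the boundary data are exact. 2-exactness is only
  required for the meshes and moments actually met by the scheme, since no reconstruction is
  2-exact for all of them. The boundary data may be chosen anew in every stage.\<close>

definition admissible_stage ::
    "nat \<Rightarrow> nat \<Rightarrow> (cell_idx \<Rightarrow> cell_idx set) \<Rightarrow> 'm::finite reconstruction \<Rightarrow>
     mesh \<Rightarrow> egm \<Rightarrow> 'm::finite averages \<Rightarrow> 'm::finite boundary_data \<Rightarrow> bool" where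
  "admissible_stage Nx Ny S R X M U b \<longleftrightarrow>
     (\<forall>K\<in>cells Nx Ny. M 0 0 K \<noteq> 0) \<and> two_exact Nx Ny S R X M \<and> exact_boundary Nx Ny X M U b"

section \<open>Step 1: physical evolution on a fixed mesh\<close>

definition outer :: "real^'m \<Rightarrow> real^2 \<Rightarrow> real^2^'m" where
  "outer u w = (\<chi> i j. u $ i * w $ j)"

definition flux_F :: "real^2 \<Rightarrow> real^'m \<Rightarrow> real^2^'m" where
  "flux_F a u = outer u a"

definition phys_L ::
    "nat \<Rightarrow> nat \<Rightarrow> 'm::finite reconstruction \<Rightarrow> real^2 \<Rightarrow> 'm::finite boundary_data \<Rightarrow>
     mesh \<Rightarrow> egm \<Rightarrow> 'm::finite averages \<Rightarrow> 'm::finite averages" where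
  "phys_L Nx Ny R a b X M U K =
     - ((1 / M 0 0 K) *\<^sub>R (\<Sum>k=1..4. edge_length X K k *\<^sub>R (\<Sum>g=1..3. gl_weight g *\<^sub>R
         (let n = outward_normal X K k;
              ui = int_state R X M U K k g;
              ue = ext_state Nx Ny R b X M U K k g
          in (1/2) *\<^sub>R (flux_F a ui *v n + flux_F a ue *v n - \<bar>a \<bullet> n\<bar> *\<^sub>R (ue - ui))))))"

definition phys_step ::
    "nat \<Rightarrow> nat \<Rightarrow> (cell_idx \<Rightarrow> cell_idx set) \<Rightarrow> 'm::finite reconstruction \<Rightarrow> real^2 \<Rightarrow> real \<Rightarrow>
     mesh \<Rightarrow> egm \<Rightarrow> 'm::finite averages \<Rightarrow> 'm::finite averages \<Rightarrow> bool" where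
  "phys_step Nx Ny S R a dt X M U U' \<longleftrightarrow> (\<exists>b0 b1 b2 U1 U2.
     admissible_stage Nx Ny S R X M U b0 \<and>
     admissible_stage Nx Ny S R X M U1 b1 \<and>
     admissible_stage Nx Ny S R X M U2 b2 \<and>
     U1 = (\<lambda>K. U K + dt *\<^sub>R phys_L Nx Ny R a b0 X M U K) \<and>
     U2 = (\<lambda>K. (3/4) *\<^sub>R U K + (1/4) *\<^sub>R (U1 K + dt *\<^sub>R phys_L Nx Ny R a b1 X M U1 K)) \<and>
     U' = (\<lambda>K. (1/3) *\<^sub>R U K + (2/3) *\<^sub>R (U2 K + dt *\<^sub>R phys_L Nx Ny R a b2 X M U2 K)))"

section \<open>Step 2: rezoning\<close>

definition vertex_velocity :: "mesh \<Rightarrow> mesh \<Rightarrow> real \<Rightarrow> nat \<times> nat \<Rightarrow> real^2" where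
  "vertex_velocity X X' \<tau>f P = (1 / \<tau>f) *\<^sub>R (X' P - X P)"

definition moving_mesh :: "mesh \<Rightarrow> mesh \<Rightarrow> real \<Rightarrow> real \<Rightarrow> mesh" where
  "moving_mesh X X' \<tau>f \<tau> P = X P + \<tau> *\<^sub>R vertex_velocity X X' \<tau>f P"

definition regular_motion :: "nat \<Rightarrow> nat \<Rightarrow> mesh \<Rightarrow> mesh \<Rightarrow> real \<Rightarrow> bool" where
  "regular_motion Nx Ny X X' \<tau>f \<longleftrightarrow>
     (\<forall>\<tau>\<in>{0..\<tau>f}. \<forall>K\<in>cells Nx Ny. regular_cell (moving_mesh X X' \<tau>f \<tau>) K)"

section \<open>Step 3: remapping\<close>

definition flux_G :: "real^'m \<Rightarrow> real^2 \<Rightarrow> real^2^'m" where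
  "flux_G u w = - outer u w"

definition remap_LM :: "(nat \<times> nat \<Rightarrow> real^2) \<Rightarrow> mesh \<Rightarrow> egm" where
  "remap_LM w X s r K = (\<Sum>k=1..4. edge_length X K k * (\<Sum>g=1..3. gl_weight g *
     (edge_pt X K k g $ 1) ^ s * (edge_pt X K k g $ 2) ^ r *
     (edge_pt w K k g \<bullet> outward_normal X K k)))"

definition averages_of :: "egm \<Rightarrow> (cell_idx \<Rightarrow> real^'m) \<Rightarrow> 'm::finite averages" where
  "averages_of M V K = (1 / M 0 0 K) *\<^sub>R V K"

definition remap_LV ::
    "nat \<Rightarrow> nat \<Rightarrow> 'm::finite reconstruction \<Rightarrow> (nat \<times> nat \<Rightarrow> real^2) \<Rightarrow> 'm::finite boundary_data \<Rightarrow>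
     mesh \<Rightarrow> egm \<Rightarrow> (cell_idx \<Rightarrow> real^'m) \<Rightarrow> cell_idx \<Rightarrow> real^'m" where
  "remap_LV Nx Ny R w b X M V K =
     - (\<Sum>k=1..4. edge_length X K k *\<^sub>R (\<Sum>g=1..3. gl_weight g *\<^sub>R
         (let n = outward_normal X K k;
              wg = edge_pt w K k g;
              amax = Max ((\<lambda>h. \<bar>edge_pt w K k h \<bullet> n\<bar>) ` {1..3});
              ui = int_state R X M (averages_of M V) K k g;
              ue = ext_state Nx Ny R b X M (averages_of M V) K k g
          in (1/2) *\<^sub>R (flux_G ui wg *v n + flux_G ue wg *v n - amax *\<^sub>R (ue - ui)))))"

text \<open>One pseudo-time step of size \<open>d\<close> from pseudo-time \<open>\<tau>\<close>; \<open>Y\<close> is the moving mesh as a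
  function of pseudo-time and \<open>w\<close> its constant vertex velocity.\<close>

definition remap_step ::
    "nat \<Rightarrow> nat \<Rightarrow> (cell_idx \<Rightarrow> cell_idx set) \<Rightarrow> 'm::finite reconstruction \<Rightarrow>
     (nat \<times> nat \<Rightarrow> real^2) \<Rightarrow> (real \<Rightarrow> mesh) \<Rightarrow> real \<Rightarrow> real \<Rightarrow>
     egm \<Rightarrow> (cell_idx \<Rightarrow> real^'m) \<Rightarrow> egm \<Rightarrow> (cell_idx \<Rightarrow> real^'m) \<Rightarrow> bool" where
  "remap_step Nx Ny S R w Y \<tau> d M V M' V' \<longleftrightarrow> (\<exists>b0 b1 b2 M1 V1 M2 V2.
     admissible_stage Nx Ny S R (Y \<tau>) M (averages_of M V) b0 \<and>
     admissible_stage Nx Ny S R (Y (\<tau> + d)) M1 (averages_of M1 V1) b1 \<and>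
     admissible_stage Nx Ny S R (Y (\<tau> + d / 2)) M2 (averages_of M2 V2) b2 \<and>
     M1 = (\<lambda>s r K. M s r K + d * remap_LM w (Y \<tau>) s r K) \<and>
     V1 = (\<lambda>K. V K + d *\<^sub>R remap_LV Nx Ny R w b0 (Y \<tau>) M V K) \<and>
     M2 = (\<lambda>s r K. 3/4 * M s r K + 1/4 * (M1 s r K + d * remap_LM w (Y (\<tau> + d)) s r K)) \<and>
     V2 = (\<lambda>K. (3/4) *\<^sub>R V K
            + (1/4) *\<^sub>R (V1 K + d *\<^sub>R remap_LV Nx Ny R w b1 (Y (\<tau> + d)) M1 V1 K)) \<and>
     M' = (\<lambda>s r K. 1/3 * M s r K + 2/3 * (M2 s r K + d * remap_LM w (Y (\<tau> + d / 2)) s r K)) \<and>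
     V' = (\<lambda>K. (1/3) *\<^sub>R V K
            + (2/3) *\<^sub>R (V2 K + d *\<^sub>R remap_LV Nx Ny R w b2 (Y (\<tau> + d / 2)) M2 V2 K)))"

text \<open>\<open>remap_run \<dots> \<tau> M V\<close>: the state \<open>(M, V)\<close> is reached at pseudo-time \<open>\<tau>\<close> from \<open>(M0, V0)\<close> by
  pseudo-time steps of arbitrary, possibly varying, positive sizes.\<close>

inductive remap_run ::
    "nat \<Rightarrow> nat \<Rightarrow> (cell_idx \<Rightarrow> cell_idx set) \<Rightarrow> 'm::finite reconstruction \<Rightarrow>
     (nat \<times> nat \<Rightarrow> real^2) \<Rightarrow> (real \<Rightarrow> mesh) \<Rightarrow> real \<Rightarrow> egm \<Rightarrow> (cell_idx \<Rightarrow> real^'m) \<Rightarrow>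
     real \<Rightarrow> egm \<Rightarrow> (cell_idx \<Rightarrow> real^'m) \<Rightarrow> bool"
  for Nx Ny S R w Y \<tau>f M0 V0 where
  start: "remap_run Nx Ny S R w Y \<tau>f M0 V0 0 M0 V0"
| step: "remap_run Nx Ny S R w Y \<tau>f M0 V0 \<tau> M V \<Longrightarrow> d > 0 \<Longrightarrow> \<tau> + d \<le> \<tau>f \<Longrightarrow>
    remap_step Nx Ny S R w Y \<tau> d M V M' V' \<Longrightarrow>
    remap_run Nx Ny S R w Y \<tau>f M0 V0 (\<tau> + d) M' V'"

text \<open>One pass through Steps 2 and 3, from mesh, moments and averages \<open>(X, M, U)\<close> to
  \<open>(X', M', U')\<close>, with an arbitrary new mesh \<open>X'\<close>.\<close>

definition rezone_remap ::
    "nat \<Rightarrow> nat \<Rightarrow> (cell_idx \<Rightarrow> cell_idx set) \<Rightarrow> 'm::finite reconstruction \<Rightarrow>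
     mesh \<times> egm \<times> 'm::finite averages \<Rightarrow> mesh \<times> egm \<times> 'm::finite averages \<Rightarrow> bool" where
  "rezone_remap Nx Ny S R = (\<lambda>(X, M, U) (X', M', U'). \<exists>\<tau>f V'.
     \<tau>f > 0 \<and> regular_motion Nx Ny X X' \<tau>f \<and>
     remap_run Nx Ny S R (vertex_velocity X X' \<tau>f) (moving_mesh X X' \<tau>f) \<tau>f
       M (\<lambda>K. M 0 0 K *\<^sub>R U K) \<tau>f M' V' \<and>
     (\<forall>K\<in>cells Nx Ny. M' 0 0 K \<noteq> 0) \<and>
     U' = averages_of M' V')"

section \<open>The fully discrete scheme\<close>

text \<open>
  \<open>rmm_state Nx Ny S R a U0 n t X M U\<close>: some run of the scheme for advection velocity \<open>a\<close> and
  initial condition \<open>U0\<close> has discrete time \<open>t\<^sup>n = t\<close> and, at that time, mesh \<open>X\<close>, evolved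
  moments \<open>M\<close> and cell averages \<open>U\<close>. The time steps \<open>dt\<close>, the pseudo-time steps and the rezoned
  meshes are arbitrary and chosen anew in each step; the transitive closure allows any finite
  positive number of rezoning-remapping passes per time step.
\<close>

inductive rmm_state ::
    "nat \<Rightarrow> nat \<Rightarrow> (cell_idx \<Rightarrow> cell_idx set) \<Rightarrow> 'm::finite reconstruction \<Rightarrow>
     real^2 \<Rightarrow> (real^2 \<Rightarrow> real^'m) \<Rightarrow> nat \<Rightarrow> real \<Rightarrow> mesh \<Rightarrow> egm \<Rightarrow> 'm::finite averages \<Rightarrow> bool"
  for Nx Ny S R a U0 where
  init: "uniform_rectangular Nx Ny X \<Longrightarrow>
    (\<And>K s r. K \<in> cells Nx Ny \<Longrightarrow> s + r \<le> 2 \<Longrightarrow> M s r K = exact_moment X s r K) \<Longrightarrow>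
    (\<And>K. K \<in> cells Nx Ny \<Longrightarrow> U K = exact_average X U0 K) \<Longrightarrow>
    rmm_state Nx Ny S R a U0 0 0 X M U"
| step: "rmm_state Nx Ny S R a U0 n t X M U \<Longrightarrow> dt > 0 \<Longrightarrow>
    phys_step Nx Ny S R a dt X M U U' \<Longrightarrow>
    (rezone_remap Nx Ny S R)\<^sup>+\<^sup>+ (X, M, U') (X'', M'', U'') \<Longrightarrow>
    rmm_state Nx Ny S R a U0 (Suc n) (t + dt) X'' M'' U''"

end

theory Submission
  imports Defs "HOL-Computational_Algebra.Polynomial"
begin

text \<open>
  Invariant: the evolved moments are the exact moments of the current cells, and the averages are
  generated by the quadratic \<open>p(x) = U\<^sub>0(x - at)\<close>. For such data 2-exactness makes both states at every
  quadrature point equal to \<open>p\<close>, so the dissipation vanishes and the flux sums are Gauss--Lobatto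
  sums of polynomials that are at most cubic along each edge, hence exact. In the physical step
  the averages thus evolve by \<open>p' = - a \<bullet> \<nabla>p\<close>, a nilpotent linear equation which SSPRK3 solves
  exactly. In the remapping step the moments of a cell with linearly moving vertices are quartic
  in pseudo-time, and SSPRK3 applied to a pure quadrature problem is Simpson's rule, which is
  exact for their cubic derivatives; the polynomial \<open>p\<close> does not change.
\<close>

section \<open>Moments of triangles and convex quadrilaterals\<close>

text \<open>Twice the signed area of the triangle \<open>P\<close>, \<open>Q\<close>,
  \<open>R\<close>: the quantity whose sign \<open>strictly_ccw\<close> tests.\<close>

definition tri_det :: "real^2 \<Rightarrow> real^2 \<Rightarrow> real^2 \<Rightarrow> real" where
  "tri_det P Q R = (Q - P) $ 1 * (R - P) $ 2 - (Q - P) $ 2 * (R - P) $ 1"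

lemma integrable_continuous_compact:
  fixes f :: "'a::euclidean_space \<Rightarrow> 'b::euclidean_space"
  assumes "compact S" "continuous_on S f"
  shows "f absolutely_integrable_on S"
proof -
  have "integrable lborel (\<lambda>x. indicator S x *\<^sub>R f x)"
    by (rule borel_integrable_compact[OF assms])
  then show ?thesis
    by (simp add: set_integrable_def integrable_completion borel_measurable_integrable)
qed

section \<open>Triangle integrals via the reference triangle\<close>

abbreviation std_triangle :: "(real^2) set" where
  "std_triangle \<equiv> convex hull {0, axis 1 1, axis 2 1}"

lemma compact_triangle [simp]: "compact (convex hull {A, B, C :: real^2})"
  by (simp add: finite_imp_compact_convex_hull)

lemma integral_triangle_affine:
  fixes f :: "real^2 \<Rightarrow> real"
  assumes "tri_det A B C \<noteq> 0" "continuous_on UNIV f"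
  shows "integral (convex hull {A, B, C}) f =
    \<bar>tri_det A B C\<bar> * integral std_triangle (\<lambda>z. f (A + z $ 1 *\<^sub>R (B - A) + z $ 2 *\<^sub>R (C - A)))"
proof -
  define L where "L = (\<lambda>z::real^2. z $ 1 *\<^sub>R (B - A) + z $ 2 *\<^sub>R (C - A))"
  define g where "g = (\<lambda>z. A + L z)"
  have lin: "linear L"
    unfolding L_def by (rule linearI) (auto simp: algebra_simps)
  have det: "det (matrix L) = tri_det A B C"
    by (simp add: det_2 matrix_def L_def tri_det_def axis_def algebra_simps)
  have "inj L"
    using assms(1) det det_nz_iff_inj[OF lin] by simp
  then have inj: "inj_on g S" for S
    by (auto simp: g_def inj_on_def)
  have img: "g ` std_triangle = convex hull {A, B, C}"
  proof -
    have "L ` std_triangle = convex hull (L ` {0, axis 1 1, axis 2 1})"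
      by (rule convex_hull_linear_image[OF lin])
    then have "g ` std_triangle = (+) A ` (convex hull (L ` {0, axis 1 1, axis 2 1}))"
      by (simp add: g_def image_comp [symmetric] o_def image_image [symmetric])
    also have "\<dots> = convex hull ((+) A ` L ` {0, axis 1 1, axis 2 1})"
      by (simp only: convex_hull_translation)
    also have "(+) A ` L ` {0, axis 1 1, axis 2 1} = {A, B, C}"
      by (simp add: L_def axis_def)
    finally show ?thesis .
  qed
  \<comment> \<open>The change of variables theorem is applied to a vector-valued integrand, so
    \<open>f\<close> passes through \<open>real^1\<close>.\<close>
  define F where "F = (\<lambda>z. vec (f z) :: real^1)"
  have contF: "continuous_on S F" for S
    unfolding F_def vec_def by (intro continuous_on_vec_lambda continuous_on_subset[OF assms(2)]) auto
  have ai: "F absolutely_integrable_on (g ` std_triangle)"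
    unfolding img by (intro integrable_continuous_compact contF) simp
  have der: "(g has_derivative L) (at x within std_triangle)" for x
    unfolding g_def using linear_imp_has_derivative[OF lin] by (auto intro!: derivative_eq_intros)
  have m: "std_triangle \<in> sets lebesgue"
    by (simp add: compact_imp_closed)
  have "integral (g ` std_triangle) F = integral std_triangle (\<lambda>x. \<bar>det (matrix L)\<bar> *\<^sub>R F (g x))"
    by (rule integral_change_of_variables[OF m der inj disjI1[OF ai]])
  then have "integral (convex hull {A, B, C}) f = integral std_triangle (\<lambda>x. \<bar>tri_det A B C\<bar> * f (g x))"
    by (simp add: img integral_on_1_eq F_def det vec_eq_iff)
  then show ?thesis
    by (simp add: g_def L_def add.assoc)
qed

section \<open>Cutting a quadrilateral along a diagonal\<close>

text \<open>Using the relation (1-s)B + sD = (1-t)A + tC, a convex combination of the four points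
  can be rewritten without D or without B; comparing their weights decides which.\<close>

lemma convex_hull_4_split:
  fixes A B C D :: "'a::real_vector"
  assumes M: "M \<in> closed_segment B D" "M \<in> closed_segment A C"
  shows "convex hull {A, B, C, D} = convex hull {A, B, C} \<union> convex hull {A, C, D}"
proof
  show "convex hull {A, B, C} \<union> convex hull {A, C, D} \<subseteq> convex hull {A, B, C, D}"
    by (intro Un_least hull_mono) auto
next
  \<comment> \<open>Weight moves from D to A and C at the expense of B; \<open>le\<close> says that
    B has enough of it.\<close>
  have half: "a *\<^sub>R A + b *\<^sub>R B + c *\<^sub>R C + d *\<^sub>R D \<in> convex hull {A, B, C}"
    if M: "(1 - s) *\<^sub>R B + s *\<^sub>R D = (1 - t) *\<^sub>R A + t *\<^sub>R C"
      and st: "0 \<le> s" "s \<le> 1" "0 \<le> t" "t \<le> 1"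
      and abcd: "0 \<le> a" "0 \<le> b" "0 \<le> c" "0 \<le> d" "a + b + c + d = 1"
      and le: "d * (1 - s) \<le> b * s"
    for A B C D :: 'a and a b c d s t :: real
  proof -
    \<comment> \<open>Exchanging \<open>k\<close> copies of the relation removes D. If s = 0, then
      \<open>le\<close> forces d = 0 and \<open>k\<close> = 0 / 0 = 0, so d = k * s still
      holds.\<close>
    define k where "k = d / s"
    have k: "d = k * s" "0 \<le> k"
      using st abcd le by (auto simp: k_def)
    have kb: "k * (1 - s) \<le> b"
    proof (cases "s = 0")
      case False
      then show ?thesis using st le by (simp add: k_def field_simps)
    qed (use abcd in \<open>simp add: k_def\<close>)
    have "d *\<^sub>R D = k *\<^sub>R ((1 - s) *\<^sub>R B + s *\<^sub>R D) - (k * (1 - s)) *\<^sub>R B"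
      by (simp add: k(1) algebra_simps)
    also have "\<dots> = (k * (1 - t)) *\<^sub>R A + (k * t) *\<^sub>R C - (k * (1 - s)) *\<^sub>R B"
      unfolding M by (simp add: algebra_simps)
    finally have "a *\<^sub>R A + b *\<^sub>R B + c *\<^sub>R C + d *\<^sub>R D =
        (a + k * (1 - t)) *\<^sub>R A + (b - k * (1 - s)) *\<^sub>R B + (c + k * t) *\<^sub>R C"
      by (simp add: algebra_simps)
    moreover have "(a + k * (1 - t)) + (b - k * (1 - s)) + (c + k * t) = 1"
      using abcd(5) k(1) by (simp add: algebra_simps)
    ultimately show ?thesis
      unfolding convex_hull_3 using abcd k kb st
      by (intro CollectI exI[of _ "a + k * (1 - t)"] exI[of _ "b - k * (1 - s)"] exI[of _ "c + k * t"]) auto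
  qed
  obtain s where s: "0 \<le> s" "s \<le> 1" "M = (1 - s) *\<^sub>R B + s *\<^sub>R D"
    using M(1) by (auto simp: in_segment)
  obtain t where t: "0 \<le> t" "t \<le> 1" "M = (1 - t) *\<^sub>R A + t *\<^sub>R C"
    using M(2) by (auto simp: in_segment)
  show "convex hull {A, B, C, D} \<subseteq> convex hull {A, B, C} \<union> convex hull {A, C, D}"
  proof
    fix z assume "z \<in> convex hull {A, B, C, D}"
    then obtain a v b' c' d' where "0 \<le> a" "0 \<le> v" "a + v = 1" "0 \<le> b'" "0 \<le> c'" "0 \<le> d'"
      "b' + c' + d' = 1" "z = a *\<^sub>R A + v *\<^sub>R (b' *\<^sub>R B + c' *\<^sub>R C + d' *\<^sub>R D)"
      by (auto simp: convex_hull_insert[of "{B, C, D}"] convex_hull_3)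
    moreover from this have "a + v * b' + v * c' + v * d' = 1"
      by (simp add: add.assoc flip: distrib_left)
    moreover define b c d where "b = v * b'" and "c = v * c'" and "d = v * d'"
    ultimately have abcd: "0 \<le> a" "0 \<le> b" "0 \<le> c" "0 \<le> d" "a + b + c + d = 1"
      and z: "z = a *\<^sub>R A + b *\<^sub>R B + c *\<^sub>R C + d *\<^sub>R D"
      by (auto simp: algebra_simps)
    show "z \<in> convex hull {A, B, C} \<union> convex hull {A, C, D}"
    proof (cases "d * (1 - s) \<le> b * s")
      case True
      then show ?thesis
        using half[of s B D t A C a b c d] s t abcd z by auto
    next
      case False
      \<comment> \<open>The same argument after swapping A with C and B with D.\<close>
      have "c *\<^sub>R C + d *\<^sub>R D + a *\<^sub>R A + b *\<^sub>R B \<in> convex hull {C, D, A}"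
        by (rule half[of "1 - s" D B "1 - t" C A c d a b])
          (use False s t abcd in \<open>auto simp: algebra_simps\<close>)
      moreover have "{C, D, A} = {A, C, D}" by auto
      ultimately show ?thesis
        using z by (simp add: algebra_simps)
    qed
  qed
qed

lemma tri_det_cycle: "tri_det B C A = tri_det A B C"
  by (simp add: tri_det_def algebra_simps)

text \<open>\<open>tri_det A C\<close> is affine in its last argument and vanishes at A and C, so at
  a point of the triangle it is the weight of B times its value at B.\<close>

lemma tri_det_nonneg_triangle:
  assumes "tri_det A C B \<ge> 0" "z \<in> convex hull {A, B, C}"
  shows "tri_det A C z \<ge> 0"
proof -
  obtain u v w where uvw: "0 \<le> u" "0 \<le> v" "0 \<le> w" "u + v + w = 1"
    and z: "z = u *\<^sub>R A + v *\<^sub>R B + w *\<^sub>R C"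
    using assms(2) by (auto simp: convex_hull_3)
  have u: "u = 1 - v - w" using uvw by simp
  have "tri_det A C z = v * tri_det A C B"
    unfolding z u by (simp add: tri_det_def algebra_simps)
  then show ?thesis using assms(1) uvw by simp
qed

lemma tri_det_nonpos_triangle:
  assumes "tri_det A C B \<le> 0" "z \<in> convex hull {A, B, C}"
  shows "tri_det A C z \<le> 0"
proof -
  have "tri_det C A B \<ge> 0" and *: "tri_det C A z = - tri_det A C z"
    using assms(1) by (simp_all add: tri_det_def algebra_simps)
  moreover have "{C, B, A} = {A, B, C}" by auto
  ultimately show ?thesis
    using tri_det_nonneg_triangle[of C A B z] assms(2) by simp
qed

lemma negligible_line:
  assumes "A \<noteq> C"
  shows "negligible {z. tri_det A C z = 0}"
proof -
  define n :: "real^2" where "n = vector [- ((C - A) $ 2), (C - A) $ 1]"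
  have "n \<noteq> 0"
    using assms by (auto simp: n_def vec_eq_iff forall_2)
  then have "negligible {z. n \<bullet> z = n \<bullet> A}"
    by (intro negligible_hyperplane) simp
  moreover have "{z. n \<bullet> z = n \<bullet> A} = {z. tri_det A C z = 0}"
    by (auto simp: n_def tri_det_def inner_vec_def sum_2 algebra_simps)
  ultimately show ?thesis by simp
qed

text \<open>The two triangles lie on opposite sides of the line AC, so they overlap in a null set.
  Assuming a meeting point \<open>M\<close> instead of strict convexity also admits a triangle with
  a fourth vertex on one of its sides.\<close>

lemma integral_quadrilateral_split:
  fixes f :: "real^2 \<Rightarrow> real"
  assumes "tri_det A B C > 0" "tri_det A C D > 0" "continuous_on UNIV f"
    and M: "M \<in> closed_segment B D" "M \<in> closed_segment A C"
  shows "integral (convex hull {A, B, C, D}) f =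
    integral (convex hull {A, B, C}) f + integral (convex hull {A, C, D}) f"
proof -
  have int: "f integrable_on convex hull {P, Q, R}" for P Q R
    by (intro set_lebesgue_integral_eq_integral(1) integrable_continuous_compact)
      (auto intro: continuous_on_subset[OF assms(3)])
  have ne: "A \<noteq> C" using assms(1) by (auto simp: tri_det_def)
  have b: "tri_det A C B \<le> 0" using assms(1) by (simp add: tri_det_def algebra_simps)
  have "convex hull {A, B, C} \<inter> convex hull {A, C, D} \<subseteq> {z. tri_det A C z = 0}"
  proof
    fix z assume z: "z \<in> convex hull {A, B, C} \<inter> convex hull {A, C, D}"
    have "{A, D, C} = {A, C, D}" by auto
    then have "tri_det A C z \<ge> 0"
      using tri_det_nonneg_triangle[of A C D z] assms(2) z by simp
    moreover have "tri_det A C z \<le> 0"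
      using tri_det_nonpos_triangle[of A C B z] b z by simp
    ultimately show "z \<in> {z. tri_det A C z = 0}" by simp
  qed
  then have "negligible (convex hull {A, B, C} \<inter> convex hull {A, C, D})"
    using negligible_line[OF ne] negligible_subset by blast
  then have "(f has_integral integral (convex hull {A, B, C}) f + integral (convex hull {A, C, D}) f)
      (convex hull {A, B, C} \<union> convex hull {A, C, D})"
    by (intro has_integral_Un integrable_integral int)
  then show ?thesis
    unfolding convex_hull_4_split[OF M] by (rule integral_unique)
qed

text \<open>B and D have distances from the line AC in the ratio of the areas of ABC and CDA, so AC
  cuts BD in the ratio p : q; likewise BD cuts AC in the ratio p' : q'. Both sums are twice the
  total area.\<close>

lemma convex_quadrilateral_diagonals_meet:
  assumes "tri_det A B C > 0" "tri_det B C D > 0" "tri_det C D A > 0" "tri_det D A B > 0"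
  obtains M where "M \<in> closed_segment B D" "M \<in> closed_segment A C"
proof -
  define p q where "p = tri_det A B C" and "q = tri_det C D A"
  define p' q' where "p' = tri_det D A B" and "q' = tri_det B C D"
  have pos: "p > 0" "q > 0" "p' > 0" "q' > 0"
    using assms by (auto simp: p_def q_def p'_def q'_def)
  have sum: "p + q = p' + q'"
    by (simp add: p_def q_def p'_def q'_def tri_det_def algebra_simps)
  define s t where "s = p / (p + q)" and "t = p' / (p + q)"
  have st: "(p + q) * s = p" "(p + q) * (1 - s) = q" "(p + q) * t = p'" "(p + q) * (1 - t) = q'"
    using pos sum by (auto simp: s_def t_def right_diff_distrib)
  have "(p + q) *\<^sub>R ((1 - s) *\<^sub>R B + s *\<^sub>R D) = q *\<^sub>R B + p *\<^sub>R D"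
    by (simp only: scaleR_add_right scaleR_scaleR st)
  moreover have "(p + q) *\<^sub>R ((1 - t) *\<^sub>R A + t *\<^sub>R C) = q' *\<^sub>R A + p' *\<^sub>R C"
    by (simp only: scaleR_add_right scaleR_scaleR st)
  moreover have "q *\<^sub>R B + p *\<^sub>R D = q' *\<^sub>R A + p' *\<^sub>R C"
    by (simp add: p_def q_def p'_def q'_def tri_det_def vec_eq_iff forall_2 algebra_simps)
  ultimately have eq: "(1 - s) *\<^sub>R B + s *\<^sub>R D = (1 - t) *\<^sub>R A + t *\<^sub>R C"
    using pos by (metis add_pos_pos less_irrefl scaleR_left_imp_eq)
  have "0 \<le> s" "s \<le> 1" "0 \<le> t" "t \<le> 1"
    using pos sum by (auto simp: s_def t_def)
  then show ?thesis
    using that[of "(1 - s) *\<^sub>R B + s *\<^sub>R D"] eq unfolding in_segment by blast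
qed


section \<open>Quadratic integrands over triangles\<close>

definition quadratic :: "real \<Rightarrow> real \<Rightarrow> real \<Rightarrow> real \<Rightarrow> real \<Rightarrow> real \<Rightarrow> real^2 \<Rightarrow> real" where
  "quadratic c0 c1 c2 c3 c4 c5 z =
     c0 + c1 * z $ 1 + c2 * z $ 2 + c3 * (z $ 1)\<^sup>2 + c4 * (z $ 1 * z $ 2) + c5 * (z $ 2)\<^sup>2"

lemma continuous_on_quadratic [continuous_intros]: "continuous_on S (quadratic c0 c1 c2 c3 c4 c5)"
  unfolding quadratic_def by (intro continuous_intros)

lemma integrable_std_triangle:
  "continuous_on UNIV f \<Longrightarrow> f integrable_on std_triangle" for f :: "real^2 \<Rightarrow> real"
  by (intro set_lebesgue_integral_eq_integral(1) integrable_continuous_compact)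
    (auto intro: continuous_on_subset)

lemma integral_std_triangle_1: "integral std_triangle (\<lambda>_. 1 :: real) = 1/2"
proof -
  have "std_triangle \<in> lmeasurable"
    by (simp add: lmeasurable_compact)
  then have "integral std_triangle (\<lambda>_. 1 :: real) = measure lebesgue std_triangle"
    by (simp add: lmeasure_integral)
  also have "\<dots> = measure lborel std_triangle"
    by (intro measure_completion) (simp add: compact_imp_closed)
  also have "\<dots> = 1/2"
    by (simp add: content_triangle axis_def)
  finally show ?thesis .
qed

lemma integral_std_triangle_quadratic_aux:
  "integral std_triangle (quadratic c0 c1 c2 c3 c4 c5) =
     c0 / 2 + c1 * integral std_triangle (\<lambda>z. z $ 1) + c2 * integral std_triangle (\<lambda>z. z $ 2)
     + c3 * integral std_triangle (\<lambda>z. (z $ 1)\<^sup>2) + c4 * integral std_triangle (\<lambda>z. z $ 1 * z $ 2)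
     + c5 * integral std_triangle (\<lambda>z. (z $ 2)\<^sup>2)"
proof -
  have mult: "((\<lambda>z. c * f z) has_integral c * integral std_triangle f) std_triangle"
    if "continuous_on UNIV f" for c and f :: "real^2 \<Rightarrow> real"
    using integrable_std_triangle[OF that] by (intro has_integral_mult_right integrable_integral)
  have "((\<lambda>z. c0 * 1 + c1 * z $ 1 + c2 * z $ 2 + c3 * (z $ 1)\<^sup>2 + c4 * (z $ 1 * z $ 2) + c5 * (z $ 2)\<^sup>2)
     has_integral c0 * integral std_triangle (\<lambda>_. 1) + c1 * integral std_triangle (\<lambda>z. z $ 1)
     + c2 * integral std_triangle (\<lambda>z. z $ 2)
     + c3 * integral std_triangle (\<lambda>z. (z $ 1)\<^sup>2) + c4 * integral std_triangle (\<lambda>z. z $ 1 * z $ 2)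
     + c5 * integral std_triangle (\<lambda>z. (z $ 2)\<^sup>2)) std_triangle"
    by (intro has_integral_add mult continuous_intros)
  then show ?thesis
    by (simp add: quadratic_def[abs_def] integral_std_triangle_1 integral_unique)
qed

text \<open>Rotating the three vertices is an affine map of the triangle onto itself with
  determinant 1.\<close>

lemma integral_std_triangle_cycle:
  fixes f :: "real^2 \<Rightarrow> real"
  assumes "continuous_on UNIV f"
  shows "integral std_triangle f = integral std_triangle (\<lambda>z. f (vector [1 - z $ 1 - z $ 2, z $ 1]))"
proof -
  let ?e = "axis 1 1 :: real^2" and ?f = "axis 2 1 :: real^2"
  have "tri_det ?e ?f 0 = 1" by (simp add: tri_det_def axis_def)
  moreover have "{?e, ?f, 0} = {0, ?e, ?f}" by auto
  moreover have "?e + z $ 1 *\<^sub>R (?f - ?e) + z $ 2 *\<^sub>R (0 - ?e) = vector [1 - z $ 1 - z $ 2, z $ 1]" for z :: "real^2"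
    by (simp add: vec_eq_iff forall_2 axis_def)
  ultimately show ?thesis
    using integral_triangle_affine[of ?e ?f 0, OF _ assms] by simp
qed

text \<open>The cut joins the origin to the midpoint of the opposite side; both halves are affine
  images with determinant 1/2.\<close>

lemma integral_std_triangle_bisect:
  fixes f :: "real^2 \<Rightarrow> real"
  assumes "continuous_on UNIV f"
  shows "integral std_triangle f =
    integral std_triangle (\<lambda>z. f (vector [z $ 1 + z $ 2 / 2, z $ 2 / 2])) / 2 +
    integral std_triangle (\<lambda>z. f (vector [z $ 1 / 2, z $ 1 / 2 + z $ 2])) / 2"
proof -
  let ?e = "axis 1 1 :: real^2" and ?f = "axis 2 1 :: real^2" and ?m = "vector [1/2, 1/2] :: real^2"
  have det: "tri_det 0 ?e ?m = 1/2" "tri_det 0 ?m ?f = 1/2" by (simp_all add: tri_det_def axis_def)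
  have m: "?m \<in> closed_segment ?e ?f"
    unfolding in_segment by (intro conjI exI[of _ "1/2"]) (auto simp: vec_eq_iff forall_2 axis_def)
  then have "?m \<in> convex hull {0, ?e, ?f}"
    using segment_convex_hull hull_mono[of "{?e, ?f}" "{0, ?e, ?f}" convex] by auto
  then have "convex hull {0, ?e, ?m, ?f} = std_triangle"
    using hull_redundant[of ?m convex "{0, ?e, ?f}"] by (simp add: insert_commute)
  then have "integral std_triangle f =
      integral (convex hull {0, ?e, ?m}) f + integral (convex hull {0, ?m, ?f}) f"
    using integral_quadrilateral_split[of 0 ?e ?m ?f f ?m] det m assms by simp
  also have "integral (convex hull {0, ?e, ?m}) f =
      integral std_triangle (\<lambda>z. f (z $ 1 *\<^sub>R ?e + z $ 2 *\<^sub>R ?m)) / 2"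
    using integral_triangle_affine[of 0 ?e ?m, OF _ assms] det by simp
  also have "(\<lambda>z. f (z $ 1 *\<^sub>R ?e + z $ 2 *\<^sub>R ?m)) = (\<lambda>z. f (vector [z $ 1 + z $ 2 / 2, z $ 2 / 2]))"
    by (intro ext arg_cong[of _ _ f]) (simp add: vec_eq_iff forall_2 axis_def)
  also have "integral (convex hull {0, ?m, ?f}) f =
      integral std_triangle (\<lambda>z. f (z $ 1 *\<^sub>R ?m + z $ 2 *\<^sub>R ?f)) / 2"
    using integral_triangle_affine[of 0 ?m ?f, OF _ assms] det by simp
  also have "(\<lambda>z. f (z $ 1 *\<^sub>R ?m + z $ 2 *\<^sub>R ?f)) = (\<lambda>z. f (vector [z $ 1 / 2, z $ 1 / 2 + z $ 2]))"
    by (intro ext arg_cong[of _ _ f]) (simp add: vec_eq_iff forall_2 axis_def)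
  finally show ?thesis .
qed

text \<open>The affine symmetries of the triangle determine the first moments and leave one free parameter
  for the second moments; comparing the triangle with its two halves fixes that parameter, so no
  iterated integral is needed.\<close>

lemma integral_std_triangle_quadratic:
  "integral std_triangle (quadratic c0 c1 c2 c3 c4 c5) =
     c0 / 2 + c1 / 6 + c2 / 6 + c3 / 12 + c4 / 24 + c5 / 12"
proof -
  let ?J = "integral std_triangle :: (real^2 \<Rightarrow> real) \<Rightarrow> real"
  let ?x = "?J (\<lambda>z. z $ 1)" and ?y = "?J (\<lambda>z. z $ 2)" and ?xx = "?J (\<lambda>z. (z $ 1)\<^sup>2)"
    and ?xy = "?J (\<lambda>z. z $ 1 * z $ 2)" and ?yy = "?J (\<lambda>z. (z $ 2)\<^sup>2)"
  note J = integral_std_triangle_quadratic_aux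
  have y: "?y = ?x"
    by (subst integral_std_triangle_cycle) (auto intro!: continuous_intros)
  have yy: "?yy = ?xx"
    by (subst integral_std_triangle_cycle) (auto intro!: continuous_intros)
  have "?x = ?J (\<lambda>z. 1 - z $ 1 - z $ 2)"
    by (subst integral_std_triangle_cycle) (auto intro!: continuous_intros)
  also have "(\<lambda>z. 1 - z $ 1 - z $ 2) = quadratic 1 (-1) (-1) 0 0 0"
    by (simp add: quadratic_def fun_eq_iff)
  finally have x: "?x = 1/6"
    unfolding J using y by simp
  have "?xy = ?J (\<lambda>z. (1 - z $ 1 - z $ 2) * z $ 1)"
    by (subst integral_std_triangle_cycle) (auto intro!: continuous_intros)
  also have "(\<lambda>z. (1 - z $ 1 - z $ 2) * z $ 1) = quadratic 0 1 0 (-1) (-1) 0"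
    by (simp add: quadratic_def fun_eq_iff power2_eq_square algebra_simps)
  finally have xy1: "2 * ?xy = ?x - ?xx"
    unfolding J by simp
  have "?xy = ?J (\<lambda>z. (z $ 1 + z $ 2 / 2) * (z $ 2 / 2)) / 2 + ?J (\<lambda>z. z $ 1 / 2 * (z $ 1 / 2 + z $ 2)) / 2"
    by (subst integral_std_triangle_bisect) (auto intro!: continuous_intros)
  also have "(\<lambda>z. (z $ 1 + z $ 2 / 2) * (z $ 2 / 2)) = quadratic 0 0 0 0 (1/2) (1/4)"
    by (simp add: quadratic_def fun_eq_iff power2_eq_square field_simps)
  also have "(\<lambda>z. z $ 1 / 2 * (z $ 1 / 2 + z $ 2)) = quadratic 0 0 0 (1/4) (1/2) 0"
    by (simp add: quadratic_def fun_eq_iff power2_eq_square field_simps)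
  finally have "?xy = ?xx / 2"
    unfolding J yy by (simp add: field_simps)
  with xy1 x have xx: "?xx = 1/12" and xy: "?xy = 1/24" by simp_all
  show ?thesis
    unfolding J x y yy xx xy by simp
qed

text \<open>This is the edge midpoint rule, with weight one third of the area; after pulling back to
  the reference triangle, both sides are the same linear form in the coefficients.\<close>

lemma integral_triangle_quadratic:
  assumes "tri_det A B C > 0"
  shows "integral (convex hull {A, B, C}) (quadratic c0 c1 c2 c3 c4 c5) = tri_det A B C / 6 *
    (quadratic c0 c1 c2 c3 c4 c5 ((1/2) *\<^sub>R (A + B)) + quadratic c0 c1 c2 c3 c4 c5 ((1/2) *\<^sub>R (B + C)) +
     quadratic c0 c1 c2 c3 c4 c5 ((1/2) *\<^sub>R (C + A)))"
proof -
  define a1 a2 where "a1 = A $ 1" and "a2 = A $ 2"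
  define p1 p2 where "p1 = (B - A) $ 1" and "p2 = (B - A) $ 2"
  define q1 q2 where "q1 = (C - A) $ 1" and "q2 = (C - A) $ 2"
  have B: "B $ 1 = a1 + p1" "B $ 2 = a2 + p2" and C: "C $ 1 = a1 + q1" "C $ 2 = a2 + q2"
    by (simp_all add: a1_def a2_def p1_def p2_def q1_def q2_def)
  \<comment> \<open>The new coefficients are those of the Taylor expansion at A in the directions p
    = B - A and q = C - A.\<close>
  have "(\<lambda>z. quadratic c0 c1 c2 c3 c4 c5 (A + z $ 1 *\<^sub>R (B - A) + z $ 2 *\<^sub>R (C - A))) =
    quadratic (quadratic c0 c1 c2 c3 c4 c5 A)
      (c1 * p1 + c2 * p2 + 2 * c3 * a1 * p1 + c4 * (a1 * p2 + a2 * p1) + 2 * c5 * a2 * p2)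
      (c1 * q1 + c2 * q2 + 2 * c3 * a1 * q1 + c4 * (a1 * q2 + a2 * q1) + 2 * c5 * a2 * q2)
      (c3 * p1\<^sup>2 + c4 * p1 * p2 + c5 * p2\<^sup>2)
      (2 * c3 * p1 * q1 + c4 * (p1 * q2 + p2 * q1) + 2 * c5 * p2 * q2)
      (c3 * q1\<^sup>2 + c4 * q1 * q2 + c5 * q2\<^sup>2)"
    unfolding quadratic_def vector_add_component vector_scaleR_component
      p1_def[symmetric] p2_def[symmetric] q1_def[symmetric] q2_def[symmetric]
      a1_def[symmetric] a2_def[symmetric]
    by (simp add: fun_eq_iff power2_eq_square algebra_simps)
  moreover have "quadratic c0 c1 c2 c3 c4 c5 A / 2 +
      (c1 * p1 + c2 * p2 + 2 * c3 * a1 * p1 + c4 * (a1 * p2 + a2 * p1) + 2 * c5 * a2 * p2) / 6 +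
      (c1 * q1 + c2 * q2 + 2 * c3 * a1 * q1 + c4 * (a1 * q2 + a2 * q1) + 2 * c5 * a2 * q2) / 6 +
      (c3 * p1\<^sup>2 + c4 * p1 * p2 + c5 * p2\<^sup>2) / 12 +
      (2 * c3 * p1 * q1 + c4 * (p1 * q2 + p2 * q1) + 2 * c5 * p2 * q2) / 24 +
      (c3 * q1\<^sup>2 + c4 * q1 * q2 + c5 * q2\<^sup>2) / 12 =
    (quadratic c0 c1 c2 c3 c4 c5 ((1/2) *\<^sub>R (A + B)) + quadratic c0 c1 c2 c3 c4 c5 ((1/2) *\<^sub>R (B + C)) +
     quadratic c0 c1 c2 c3 c4 c5 ((1/2) *\<^sub>R (C + A))) / 6"
    unfolding quadratic_def vector_add_component vector_scaleR_component B C
      a1_def[symmetric] a2_def[symmetric]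
    by (simp add: field_simps power2_eq_square)
  ultimately show ?thesis
    using integral_triangle_affine[of A B C "quadratic c0 c1 c2 c3 c4 c5"] assms
    by (simp add: integral_std_triangle_quadratic continuous_on_quadratic)
qed

section \<open>Moments as sums over edges\<close>

text \<open>Gauss--Lobatto value of the flux of the moving edge \<open>PQ\<close>, weighted by \<open>x\<^sup>s y\<^sup>r\<close>, when
  \<open>P\<close>, \<open>Q\<close> move with velocities \<open>u\<close>, \<open>v\<close>. For \<open>u = P\<close>, \<open>v = Q\<close> the velocity is the position field,
  whose weighted flux has divergence \<open>(s + r + 2) x\<^sup>s y\<^sup>r\<close>; so the sum over the edges of a cell is
  \<open>s + r + 2\<close> times its moment.\<close>

definition edge_moment :: "nat \<Rightarrow> nat \<Rightarrow> real^2 \<Rightarrow> real^2 \<Rightarrow> real^2 \<Rightarrow> real^2 \<Rightarrow> real" where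
  "edge_moment s r P Q u v =
     1/6 * ((P $ 1) ^ s * (P $ 2) ^ r * (u $ 1 * (Q $ 2 - P $ 2) - u $ 2 * (Q $ 1 - P $ 1)))
   + 2/3 * (((P $ 1 + Q $ 1) / 2) ^ s * ((P $ 2 + Q $ 2) / 2) ^ r *
        ((u $ 1 + v $ 1) / 2 * (Q $ 2 - P $ 2) - (u $ 2 + v $ 2) / 2 * (Q $ 1 - P $ 1)))
   + 1/6 * ((Q $ 1) ^ s * (Q $ 2) ^ r * (v $ 1 * (Q $ 2 - P $ 2) - v $ 2 * (Q $ 1 - P $ 1)))"

text \<open>The length cancels the normalization of the normal, leaving the cross product of
  \<open>w\<close> with the edge vector; on an edge of length zero both sides vanish.\<close>

lemma edge_length_times_normal:
  "edge_length X K k * (w \<bullet> outward_normal X K k) =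
     w $ 1 * (corner X K (k + 1) $ 2 - corner X K k $ 2) - w $ 2 * (corner X K (k + 1) $ 1 - corner X K k $ 1)"
proof (cases "corner X K (k + 1) = corner X K k")
  case False
  then show ?thesis
    by (simp add: edge_length_def outward_normal_def Let_def dist_norm norm_minus_commute
      inner_vec_def sum_2 field_simps)
qed (simp add: edge_length_def)

lemma edge_pt_simps:
  "edge_pt X K k (Suc 0) = corner X K k"
  "edge_pt X K k 2 = (1/2) *\<^sub>R (corner X K k + corner X K (Suc k))"
  "edge_pt X K k 3 = corner X K (Suc k)"
  by (simp_all add: edge_pt_def Let_def vec_eq_iff field_simps)

lemma sum_1_3: "(\<Sum>g = 1..3::nat. f g) = f 1 + f 2 + f 3" for f :: "nat \<Rightarrow> 'a::comm_monoid_add"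
  by (simp add: numeral_eq_Suc add.assoc)

lemma sum_1_4: "(\<Sum>g = 1..4::nat. f g) = f 1 + f 2 + f 3 + f 4" for f :: "nat \<Rightarrow> 'a::comm_monoid_add"
  by (simp add: numeral_eq_Suc add.assoc)

lemma remap_LM_eq_sum_edges:
  "remap_LM w X s r K =
     edge_moment s r (corner X K 1) (corner X K 2) (corner w K 1) (corner w K 2) +
     edge_moment s r (corner X K 2) (corner X K 3) (corner w K 2) (corner w K 3) +
     edge_moment s r (corner X K 3) (corner X K 4) (corner w K 3) (corner w K 4) +
     edge_moment s r (corner X K 4) (corner X K 1) (corner w K 4) (corner w K 1)"
proof -
  \<comment> \<open>Index 5 falls into the default branch of \<open>corner\<close>, which closes the
    polygon.\<close>
  have 5: "corner Z K 5 = corner Z K 1" for Z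
    by (simp add: corner_def)
  have "edge_length X K k * (\<Sum>g=1..3. gl_weight g * (edge_pt X K k g $ 1) ^ s * (edge_pt X K k g $ 2) ^ r *
       (edge_pt w K k g \<bullet> outward_normal X K k)) =
     (\<Sum>g=1..3. gl_weight g * ((edge_pt X K k g $ 1) ^ s * (edge_pt X K k g $ 2) ^ r *
       (edge_length X K k * (edge_pt w K k g \<bullet> outward_normal X K k))))" for k
    by (simp add: sum_distrib_left mult_ac)
  also have "\<dots> k = edge_moment s r (corner X K k) (corner X K (k + 1)) (corner w K k) (corner w K (k + 1))" for k
    unfolding edge_length_times_normal sum_1_3
    by (simp add: edge_moment_def gl_weight_def edge_pt_simps)
  finally have "remap_LM w X s r K =
     (\<Sum>k=1..4. edge_moment s r (corner X K k) (corner X K (k + 1)) (corner w K k) (corner w K (k + 1)))"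
    by (simp only: remap_LM_def)
  moreover have "1 + 1 = (2::nat)" "2 + 1 = (3::nat)" "3 + 1 = (4::nat)" "4 + 1 = (5::nat)"
    by simp_all
  ultimately show ?thesis
    by (simp only: sum_1_4 5)
qed

lemma degree_le_2_cases:
  assumes "s + r \<le> (2::nat)"
  obtains "s = 0" "r = 0" | "s = 1" "r = 0" | "s = 0" "r = 1" | "s = 2" "r = 0" | "s = 1" "r = 1" | "s = 0" "r = 2"
  using assms by force

lemma monomial_quadratic:
  assumes "s + r \<le> 2"
  obtains c0 c1 c2 c3 c4 c5 where "(\<lambda>z. (z $ 1) ^ s * (z $ 2) ^ r) = quadratic c0 c1 c2 c3 c4 c5"
proof (cases rule: degree_le_2_cases[OF assms, case_names 1 2 3 4 5 6])
  case 1 then show ?thesis using that[of 1 0 0 0 0 0] by (simp add: quadratic_def fun_eq_iff)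
next
  case 2 then show ?thesis using that[of 0 1 0 0 0 0] by (simp add: quadratic_def fun_eq_iff)
next
  case 3 then show ?thesis using that[of 0 0 1 0 0 0] by (simp add: quadratic_def fun_eq_iff)
next
  case 4 then show ?thesis using that[of 0 0 0 1 0 0] by (simp add: quadratic_def fun_eq_iff)
next
  case 5 then show ?thesis using that[of 0 0 0 0 1 0] by (simp add: quadratic_def fun_eq_iff)
next
  case 6 then show ?thesis using that[of 0 0 0 0 0 1] by (simp add: quadratic_def fun_eq_iff)
qed

text \<open>With the position field as velocity, the normal flux is the constant cross product of P
  and Q, which changes sign, while the quadrature is symmetric. It makes interior diagonals
  cancel.\<close>

lemma edge_moment_self_swap:
  assumes "s + r \<le> 2"
  shows "edge_moment s r Q P Q P = - edge_moment s r P Q P Q"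
  by (rule degree_le_2_cases[OF assms(1)]; hypsubst_thin; simp add: edge_moment_def field_simps power2_eq_square)

text \<open>The divergence theorem for the monomial times the position field: the midpoint rule is
  exact inside and Gauss-Lobatto is exact on the edges. It is checked as a polynomial identity for
  each of the six monomials.\<close>

lemma triangle_edge_moments:
  assumes "s + r \<le> 2"
  defines "f \<equiv> \<lambda>z::real^2. (z $ 1) ^ s * (z $ 2) ^ r"
  shows "tri_det A B C / 6 * (f ((1/2) *\<^sub>R (A + B)) + f ((1/2) *\<^sub>R (B + C)) + f ((1/2) *\<^sub>R (C + A))) =
    (edge_moment s r A B A B + edge_moment s r B C B C + edge_moment s r C A C A) / real (s + r + 2)"
  unfolding f_def
  by (rule degree_le_2_cases[OF assms(1)]; hypsubst_thin; simp add: tri_det_def edge_moment_def field_simps power2_eq_square)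

section \<open>Simpson's rule and moving edges\<close>

lemma simpson_poly:
  fixes p :: "real poly"
  assumes "degree p \<le> 4"
  shows "poly p d - poly p 0 =
    d * (poly (pderiv p) 0 + 4 * poly (pderiv p) (d / 2) + poly (pderiv p) d) / 6"
proof -
  have "p = [:coeff p 0, coeff p 1, coeff p 2, coeff p 3, coeff p 4:]"
  proof (rule poly_eqI)
    fix n
    show "coeff p n = coeff [:coeff p 0, coeff p 1, coeff p 2, coeff p 3, coeff p 4:] n"
    proof (cases "n \<le> 4")
      case True
      then have "n \<in> {0, 1, 2, 3, 4}" by auto
      then show ?thesis by (auto simp: numeral_eq_Suc)
    next
      case False
      then show ?thesis using assms
        by (auto simp: coeff_eq_0 coeff_pCons split: nat.splits)
    qed
  qed
  then obtain a b c e f where "p = [:a, b, c, e, f:]" by blast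
  then show ?thesis
    by (simp add: pderiv_pCons field_simps)
qed

text \<open>Along the motion the left-hand side is a quartic in pseudo-time, hence Simpson's rule is exact
  for its derivative. The terms \<open>H\<close>, which come from the end points of the edge, telescope
  around a cell.\<close>

lemma edge_moment_motion:
  fixes d :: real
  assumes "s + r \<le> 2"
  obtains H where "\<And>P Q u v.
    edge_moment s r (P + d *\<^sub>R u) (Q + d *\<^sub>R v) (P + d *\<^sub>R u) (Q + d *\<^sub>R v) =
      edge_moment s r P Q P Q
      + real (s + r + 2) * (d * (edge_moment s r P Q u v
         + 4 * edge_moment s r (P + (d/2) *\<^sub>R u) (Q + (d/2) *\<^sub>R v) u v
         + edge_moment s r (P + d *\<^sub>R u) (Q + d *\<^sub>R v) u v) / 6)
      + H P u - H Q v"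
proof
  define h where "h = (\<lambda>(P :: real^2) (u :: real^2). (P $ 1) ^ s * (P $ 2) ^ r * (u $ 1 * P $ 2 - u $ 2 * P $ 1))"
  define H where "H = (\<lambda>(P :: real^2) (u :: real^2). d * (h P u + 4 * h (P + (d/2) *\<^sub>R u) u + h (P + d *\<^sub>R u) u) / 6)"
  fix P Q u v :: "real^2"
  \<comment> \<open>\<open>E\<close> is the left-hand side as a polynomial in pseudo-time, built
    from vertex coordinates of degree 1.\<close>
  define p1 p2 q1 q2 where "p1 = [:P $ 1, u $ 1:]" and "p2 = [:P $ 2, u $ 2:]"
    and "q1 = [:Q $ 1, v $ 1:]" and "q2 = [:Q $ 2, v $ 2:]"
  note pq = p1_def p2_def q1_def q2_def
  define m1 m2 where "m1 = smult (1/2) (p1 + q1)" and "m2 = smult (1/2) (p2 + q2)"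
  define cr where "cr = (\<lambda>a1 a2. a1 * (q2 - p2) - a2 * (q1 - p1) :: real poly)"
  define E where "E = smult (1/6) (p1 ^ s * p2 ^ r * cr p1 p2) + smult (2/3) (m1 ^ s * m2 ^ r * cr m1 m2)
    + smult (1/6) (q1 ^ s * q2 ^ r * cr q1 q2)"
  have deg1: "degree p1 \<le> 1" "degree p2 \<le> 1" "degree q1 \<le> 1" "degree q2 \<le> 1"
    by (auto simp: pq)
  have deg2: "degree m1 \<le> 1" "degree m2 \<le> 1"
    using deg1 by (auto simp: m1_def m2_def intro!: order_trans[OF degree_smult_le] degree_add_le)
  have degc: "degree (cr a1 a2) \<le> 2" if "degree a1 \<le> 1" "degree a2 \<le> 1" for a1 a2
    unfolding cr_def
    by (intro degree_diff_le order_trans[OF degree_mult_le]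
      order_trans[OF add_mono[OF that(1) degree_diff_le[OF deg1(4,2)]]]
      order_trans[OF add_mono[OF that(2) degree_diff_le[OF deg1(3,1)]]]) auto
  \<comment> \<open>The monomial contributes at most s + r, hence at most 2, and the cross product 2
    more.\<close>
  have degm: "degree (a1 ^ s * a2 ^ r * cr a1 a2) \<le> 4" if "degree a1 \<le> 1" "degree a2 \<le> 1" for a1 a2
  proof -
    have "degree (a ^ n) \<le> n" if "degree a \<le> 1" for a :: "real poly" and n
      using degree_power_le[of a n] mult_le_mono1[OF that, of n] by linarith
    note this[OF that(1), of s] this[OF that(2), of r]
    then show ?thesis
      using degc[OF that] assms(1) degree_mult_le[of "a1 ^ s * a2 ^ r" "cr a1 a2"]
        degree_mult_le[of "a1 ^ s" "a2 ^ r"] by linarith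
  qed
  have degE: "degree E \<le> 4"
    unfolding E_def using deg1 deg2
    by (intro degree_add_le order_trans[OF degree_smult_le] degm)
  have val: "poly E t = edge_moment s r (P + t *\<^sub>R u) (Q + t *\<^sub>R v) (P + t *\<^sub>R u) (Q + t *\<^sub>R v)" for t
  proof -
    have v: "poly p1 t = (P + t *\<^sub>R u) $ 1" "poly p2 t = (P + t *\<^sub>R u) $ 2"
      "poly q1 t = (Q + t *\<^sub>R v) $ 1" "poly q2 t = (Q + t *\<^sub>R v) $ 2"
      by (simp_all add: pq)
    then have "poly m1 t = ((P + t *\<^sub>R u) $ 1 + (Q + t *\<^sub>R v) $ 1) / 2"
      "poly m2 t = ((P + t *\<^sub>R u) $ 2 + (Q + t *\<^sub>R v) $ 2) / 2"
      by (simp_all add: m1_def m2_def)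
    with v show ?thesis
      by (simp only: E_def edge_moment_def cr_def poly_add poly_smult poly_mult poly_power poly_diff)
  qed
  \<comment> \<open>\<open>E\<close> is s + r + 2 times the signed moment of the triangle spanned by
    the origin, P and Q. Its derivative is s + r + 2 times the flux through the three moving sides;
    the sides at the origin yield the \<open>h\<close> terms.\<close>
  have der: "poly (pderiv E) t = real (s + r + 2) * edge_moment s r (P + t *\<^sub>R u) (Q + t *\<^sub>R v) u v
    + h (P + t *\<^sub>R u) u - h (Q + t *\<^sub>R v) v" for t
  proof -
    define P' Q' where "P' = P + t *\<^sub>R u" and "Q' = Q + t *\<^sub>R v"
    have v: "poly p1 t = P' $ 1" "poly p2 t = P' $ 2" "poly q1 t = Q' $ 1" "poly q2 t = Q' $ 2"
      by (simp_all add: pq P'_def Q'_def)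
    have d: "pderiv p1 = [:u $ 1:]" "pderiv p2 = [:u $ 2:]" "pderiv q1 = [:v $ 1:]" "pderiv q2 = [:v $ 2:]"
      by (simp_all add: pq pderiv_pCons)
    show ?thesis
      unfolding E_def cr_def h_def m1_def m2_def P'_def[symmetric] Q'_def[symmetric]
      by (rule degree_le_2_cases[OF assms(1)]; hypsubst_thin;
        simp add: pderiv_add pderiv_diff pderiv_smult pderiv_mult v d edge_moment_def power2_eq_square field_simps)
  qed
  have E0: "poly E 0 = edge_moment s r P Q P Q"
    using val[of 0] by simp
  have der0: "poly (pderiv E) 0 = real (s + r + 2) * edge_moment s r P Q u v + h P u - h Q v"
    using der[of 0] by simp
  show "edge_moment s r (P + d *\<^sub>R u) (Q + d *\<^sub>R v) (P + d *\<^sub>R u) (Q + d *\<^sub>R v) =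
      edge_moment s r P Q P Q
      + real (s + r + 2) * (d * (edge_moment s r P Q u v
         + 4 * edge_moment s r (P + (d/2) *\<^sub>R u) (Q + (d/2) *\<^sub>R v) u v
         + edge_moment s r (P + d *\<^sub>R u) (Q + d *\<^sub>R v) u v) / 6)
      + H P u - H Q v"
    using simpson_poly[OF degE, of d] unfolding E0 der0 unfolding val der H_def
    by (simp add: algebra_simps add_divide_distrib diff_divide_distrib)
qed

text \<open>The divergence theorem on the triangle spanned by the origin, P and Q, for the monomial
  times \<open>a\<close>. The \<open>h\<close> terms are the fluxes through the sides at the origin.
  When s or r is 0, the truncated subtraction is harmless because of the factor in front.\<close>

lemma edge_moment_const:
  fixes a :: "real^2"
  assumes "s + r \<le> 2"
  defines "h \<equiv> \<lambda>P :: real^2. (P $ 1) ^ s * (P $ 2) ^ r * (a $ 1 * P $ 2 - a $ 2 * P $ 1)"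
  shows "real (s + r + 1) * edge_moment s r P Q a a =
    real s * a $ 1 * edge_moment (s - 1) r P Q P Q + real r * a $ 2 * edge_moment s (r - 1) P Q P Q
    + h Q - h P"
  unfolding h_def
  by (rule degree_le_2_cases[OF assms(1)]; hypsubst_thin; simp add: edge_moment_def field_simps power2_eq_square)

section \<open>From single edges to whole cells\<close>

lemma corner_const: "corner (\<lambda>_. a) K k = a"
  by (simp add: corner_def split: prod.split)

lemma corner_motion: "corner (\<lambda>P. X P + d *\<^sub>R w P) K k = corner X K k + d *\<^sub>R corner w K k"
  by (simp add: corner_def split: prod.split)

lemma remap_LM_const:
  assumes "s + r \<le> 2"
  shows "real (s + r + 1) * remap_LM (\<lambda>_. a) X s r K =
    real s * a $ 1 * remap_LM X X (s - 1) r K + real r * a $ 2 * remap_LM X X s (r - 1) K"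
  unfolding remap_LM_eq_sum_edges corner_const distrib_left edge_moment_const[OF assms]
  by simp

text \<open>A discrete geometric conservation law: one \<open>H\<close> serves all edges, so its
  terms cancel around the closed cell and Simpson's rule in pseudo-time remains.\<close>

lemma remap_LM_motion:
  fixes X :: mesh and w :: "nat \<times> nat \<Rightarrow> real^2"
  assumes "s + r \<le> 2"
  defines "Y \<equiv> \<lambda>d P. X P + d *\<^sub>R w P"
  shows "remap_LM (Y d) (Y d) s r K - remap_LM X X s r K =
    real (s + r + 2) * (d * (remap_LM w X s r K + 4 * remap_LM w (Y (d/2)) s r K + remap_LM w (Y d) s r K) / 6)"
proof -
  obtain H where H: "edge_moment s r (P + d *\<^sub>R u) (Q + d *\<^sub>R v) (P + d *\<^sub>R u) (Q + d *\<^sub>R v) =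
      edge_moment s r P Q P Q + real (s + r + 2) * (d * (edge_moment s r P Q u v
       + 4 * edge_moment s r (P + (d/2) *\<^sub>R u) (Q + (d/2) *\<^sub>R v) u v
       + edge_moment s r (P + d *\<^sub>R u) (Q + d *\<^sub>R v) u v) / 6) + H P u - H Q v" for P Q u v
    using edge_moment_motion[OF assms(1), of d] by metis
  show ?thesis
    unfolding Y_def remap_LM_eq_sum_edges corner_motion H
    by (simp add: algebra_simps add_divide_distrib)
qed

text \<open>Cut the cell along AC and turn each triangle into a sum over its edges; the diagonal is
  traversed once in each direction and drops out.\<close>

lemma exact_moment_eq_remap_LM:
  assumes "regular_cell X K" "s + r \<le> 2"
  shows "exact_moment X s r K = remap_LM X X s r K / real (s + r + 2)"
proof -
  obtain A B C D where c: "corner X K 1 = A" "corner X K 2 = B" "corner X K 3 = C" "corner X K 4 = D"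
    by blast
  have pos: "tri_det A B C > 0" "tri_det B C D > 0" "tri_det C D A > 0" "tri_det D A B > 0"
    using assms(1) unfolding regular_cell_def c strictly_ccw_def tri_det_def by auto
  obtain M where M: "M \<in> closed_segment B D" "M \<in> closed_segment A C"
    using convex_quadrilateral_diagonals_meet[OF pos] .
  obtain c0 c1 c2 c3 c4 c5 where q: "(\<lambda>z. (z $ 1) ^ s * (z $ 2) ^ r) = quadratic c0 c1 c2 c3 c4 c5"
    using monomial_quadratic[OF assms(2)] .
  have tri: "integral (convex hull {P, Q, R}) (\<lambda>z. (z $ 1) ^ s * (z $ 2) ^ r) =
     (edge_moment s r P Q P Q + edge_moment s r Q R Q R + edge_moment s r R P R P) / real (s + r + 2)"
    if "tri_det P Q R > 0" for P Q R
    unfolding triangle_edge_moments[OF assms(2), symmetric] q integral_triangle_quadratic[OF that]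
    by (simp flip: q)
  have ACD: "tri_det A C D > 0"
    using pos(3) tri_det_cycle by metis
  have "exact_moment X s r K = integral (convex hull {A, B, C, D}) (\<lambda>z. (z $ 1) ^ s * (z $ 2) ^ r)"
    by (simp only: exact_moment_def cell_region_def c)
  also have "\<dots> = integral (convex hull {A, B, C}) (\<lambda>z. (z $ 1) ^ s * (z $ 2) ^ r) +
      integral (convex hull {A, C, D}) (\<lambda>z. (z $ 1) ^ s * (z $ 2) ^ r)"
    by (intro integral_quadrilateral_split[OF pos(1) ACD _ M] continuous_intros)
  also have "\<dots> = remap_LM X X s r K / real (s + r + 2)"
    unfolding tri[OF pos(1)] tri[OF ACD] remap_LM_eq_sum_edges c
    using edge_moment_self_swap[OF assms(2), of C A]
    by (simp add: add_divide_distrib diff_divide_distrib)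
  finally show ?thesis .
qed

section \<open>Averages generated by quadratic polynomials\<close>

lemma sum_degree_le_2:
  "(\<Sum>(s, r) | s + r \<le> (2::nat). f s r) = f 0 0 + f 1 0 + f 0 1 + f 2 0 + f 1 1 + f 0 2"
  for f :: "nat \<Rightarrow> nat \<Rightarrow> 'a::comm_monoid_add"
proof -
  have "{(s, r). s + r \<le> (2::nat)} = {(0, 0), (1, 0), (0, 1), (2, 0), (1, 1), (0, 2)}"
    by (auto simp: le_Suc_eq numeral_2_eq_2)
  then show ?thesis by (simp add: add.assoc)
qed

text \<open>The numerator of \<open>generated_average\<close>, bilinear in moments and coefficients;
  during remapping it is the value of the conserved variable \<open>V\<close>.\<close>

definition pairing :: "egm \<Rightarrow> (nat \<Rightarrow> nat \<Rightarrow> real^'m) \<Rightarrow> cell_idx \<Rightarrow> real^'m" where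
  "pairing M c K = (\<Sum>(s, r) | s + r \<le> 2. M s r K *\<^sub>R c s r)"

lemma generated_average_pairing: "generated_average M c K = (1 / M 0 0 K) *\<^sub>R pairing M c K"
  by (simp add: generated_average_def pairing_def)

lemma pairing_add_moments:
  "pairing (\<lambda>s r K. x * M s r K + y * N s r K) c K = x *\<^sub>R pairing M c K + y *\<^sub>R pairing N c K"
  by (simp add: pairing_def sum_degree_le_2 algebra_simps)

lemma pairing_add_coeffs:
  "pairing M (\<lambda>s r. x *\<^sub>R c s r + y *\<^sub>R c' s r) K = x *\<^sub>R pairing M c K + y *\<^sub>R pairing M c' K"
  by (simp add: pairing_def sum_degree_le_2 algebra_simps)

lemma pairing_cong:
  assumes "\<And>s r. s + r \<le> 2 \<Longrightarrow> M s r K = N s r K"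
  shows "pairing M c K = pairing N c K"
  unfolding pairing_def by (intro sum.cong) (auto simp: assms)

section \<open>Numerical fluxes of quadratic data\<close>

text \<open>The flux sum is linear in the coefficients, and for each monomial it is the very
  quadrature that drives the corresponding moment.\<close>

lemma boundary_flux_poly2:
  "(\<Sum>k=1..4. edge_length X K k *\<^sub>R (\<Sum>g=1..3. gl_weight g *\<^sub>R
     ((edge_pt w K k g \<bullet> outward_normal X K k) *\<^sub>R poly2 c (edge_pt X K k g)))) =
   pairing (remap_LM w X) c K"
  unfolding pairing_def poly2_def remap_LM_def sum_degree_le_2 sum_1_3 sum_1_4
  by (simp add: algebra_simps)

lemma outer_mult: "outer u w *v n = (w \<bullet> n) *\<^sub>R u"
  by (simp add: vec_eq_iff outer_def matrix_vector_mult_def inner_vec_def sum_distrib_left sum_distrib_right mult_ac)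

text \<open>For equal states the jump vanishes, whatever the dissipation coefficient
  \<open>x\<close>.\<close>

lemma upwind_flux_G: "(1/2) *\<^sub>R (flux_G p w *v n + flux_G p w *v n - x *\<^sub>R (p - p)) = - ((w \<bullet> n) *\<^sub>R p)"
proof -
  have "flux_G p w *v n = - (outer p w *v n)"
    by (simp add: flux_G_def vec_eq_iff matrix_vector_mult_def sum_negf)
  then show ?thesis
    by (simp add: outer_mult flip: scaleR_2)
qed

lemma upwind_flux_F: "(1/2) *\<^sub>R (flux_F a p *v n + flux_F a p *v n - x *\<^sub>R (p - p)) = (a \<bullet> n) *\<^sub>R p"
  by (simp add: flux_F_def outer_mult flip: scaleR_2)

section \<open>One Runge-Kutta stage with averages generated by a single quadratic\<close>

context
  fixes Nx Ny :: nat and S and R :: "'m::finite reconstruction" and X :: mesh and M :: egm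
    and U :: "'m averages" and b :: "'m boundary_data" and c :: "nat \<Rightarrow> nat \<Rightarrow> real^'m"
  assumes stencil: "stencil_based Nx Ny S R"
    and admissible: "admissible_stage Nx Ny S R X M U b"
    and generated: "\<And>K. K \<in> cells Nx Ny \<Longrightarrow> U K = generated_average M c K"
begin

lemma reconstruction_eq_poly2: "K \<in> cells Nx Ny \<Longrightarrow> R X M U K z = poly2 c z"
  using stencil admissible generated
  unfolding admissible_stage_def two_exact_def stencil_based_def by blast

lemma int_state_eq_poly2: "K \<in> cells Nx Ny \<Longrightarrow> int_state R X M U K k g = poly2 c (edge_pt X K k g)"
  by (simp add: int_state_def reconstruction_eq_poly2)

lemma ext_state_eq_poly2:
  "K \<in> cells Nx Ny \<Longrightarrow> k \<in> {1..4} \<Longrightarrow> g \<in> {1..3} \<Longrightarrow>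
    ext_state Nx Ny R b X M U K k g = poly2 c (edge_pt X K k g)"
  using admissible generated reconstruction_eq_poly2
  unfolding ext_state_def admissible_stage_def exact_boundary_def by presburger

text \<open>The velocity \<open>a\<close> is read as a constant vertex velocity field, so that the
  moment operator of the remapping also describes the physical flux.\<close>

lemma phys_L_generated:
  assumes "K \<in> cells Nx Ny"
  shows "phys_L Nx Ny R a b X M U K = - ((1 / M 0 0 K) *\<^sub>R pairing (remap_LM (\<lambda>_. a) X) c K)"
proof -
  have const: "edge_pt (\<lambda>_. a) K k g = a" for k g
    by (simp add: edge_pt_def corner_const flip: scaleR_left.add scaleR_left_distrib)
  have "phys_L Nx Ny R a b X M U K = - ((1 / M 0 0 K) *\<^sub>R
     (\<Sum>k=1..4. edge_length X K k *\<^sub>R (\<Sum>g=1..3. gl_weight g *\<^sub>R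
       ((edge_pt (\<lambda>_. a) K k g \<bullet> outward_normal X K k) *\<^sub>R poly2 c (edge_pt X K k g)))))"
    unfolding phys_L_def Let_def const
    \<comment> \<open>Descending through both sums supplies the ranges of k and g that the exterior
      states require.\<close>
    by (rule arg_cong[where f = uminus], rule arg_cong[where f = "scaleR _"], rule sum.cong[OF refl],
        rule arg_cong[where f = "scaleR _"], rule sum.cong[OF refl], rule arg_cong[where f = "scaleR _"])
      (simp only: int_state_eq_poly2[OF assms] ext_state_eq_poly2[OF assms] upwind_flux_F)
  then show ?thesis by (simp only: boundary_flux_poly2)
qed

end

text \<open>The minus sign in \<open>flux_G\<close> cancels the leading one, so \<open>V\<close>
  grows by the same quadrature as the moments.\<close>

lemma remap_LV_generated:
  assumes "stencil_based Nx Ny S R" "admissible_stage Nx Ny S R X M (averages_of M V) b"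
    and V: "\<And>K. K \<in> cells Nx Ny \<Longrightarrow> V K = pairing M c K"
    and K: "K \<in> cells Nx Ny"
  shows "remap_LV Nx Ny R w b X M V K = pairing (remap_LM w X) c K"
proof -
  have gen: "averages_of M V K = generated_average M c K" if "K \<in> cells Nx Ny" for K
    using V[OF that] by (simp add: averages_of_def generated_average_pairing)
  note st = int_state_eq_poly2[OF assms(1,2) gen K] ext_state_eq_poly2[OF assms(1,2) gen K]
  have "remap_LV Nx Ny R w b X M V K = -
     (\<Sum>k=1..4. edge_length X K k *\<^sub>R (\<Sum>g=1..3. gl_weight g *\<^sub>R
       (- ((edge_pt w K k g \<bullet> outward_normal X K k) *\<^sub>R poly2 c (edge_pt X K k g)))))"
    unfolding remap_LV_def Let_def
    by (rule arg_cong[where f = uminus], rule sum.cong[OF refl],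
        rule arg_cong[where f = "scaleR _"], rule sum.cong[OF refl], rule arg_cong[where f = "scaleR _"])
      (simp only: st upwind_flux_G)
  then show ?thesis
    by (simp add: sum_negf flip: boundary_flux_poly2)
qed

section \<open>Exactness of the evolution and remapping steps\<close>

text \<open>Coefficients of \<open>- a \<bullet> \<nabla> p\<close>, where \<open>p\<close> has coefficients \<open>c\<close>; entries of \<open>c\<close> beyond degree 2 are
  junk and are cut off.\<close>

definition advect :: "real^2 \<Rightarrow> (nat \<Rightarrow> nat \<Rightarrow> real^'m) \<Rightarrow> nat \<Rightarrow> nat \<Rightarrow> real^'m" where
  "advect a c s r = (if s + r \<le> 1
     then - ((a $ 1 * real (s + 1)) *\<^sub>R c (s + 1) r + (a $ 2 * real (r + 1)) *\<^sub>R c s (r + 1)) else 0)"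

text \<open>The mesh part of the invariant; regularity is included because it turns exact moments
  into edge sums.\<close>

definition exact_moments_on :: "nat \<Rightarrow> nat \<Rightarrow> mesh \<Rightarrow> egm \<Rightarrow> bool" where
  "exact_moments_on Nx Ny X M \<longleftrightarrow> (\<forall>K\<in>cells Nx Ny. regular_cell X K \<and>
     (\<forall>s r. s + r \<le> 2 \<longrightarrow> M s r K = exact_moment X s r K))"

text \<open>Integration by parts: the boundary flux of p is the cell integral of the derivative of p
  along \<open>a\<close>. Collecting the lowered moments moves the derivative onto the
  coefficients.\<close>

lemma pairing_advect:
  assumes "exact_moments_on Nx Ny X M" "K \<in> cells Nx Ny"
  shows "pairing (remap_LM (\<lambda>_. a) X) c K = - pairing M (advect a c) K"
proof -
  have M: "M s r K = remap_LM X X s r K / real (s + r + 2)" if "s + r \<le> 2" for s r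
    using assms exact_moment_eq_remap_LM that by (simp add: exact_moments_on_def)
  have LM: "remap_LM (\<lambda>_. a) X s r K =
     (real s * a $ 1 * remap_LM X X (s - 1) r K + real r * a $ 2 * remap_LM X X s (r - 1) K) / real (s + r + 1)"
    if "s + r \<le> 2" for s r
    using remap_LM_const[OF that, of a X K] by (simp add: field_simps)
  show ?thesis
    unfolding pairing_def sum_degree_le_2
    by (simp add: vec_eq_iff M LM advect_def numeral_2_eq_2 field_simps)
qed

lemma phys_stage:
  assumes "stencil_based Nx Ny S R" "exact_moments_on Nx Ny X M" "admissible_stage Nx Ny S R X M U b"
    "\<And>K. K \<in> cells Nx Ny \<Longrightarrow> U K = generated_average M c K" "K \<in> cells Nx Ny"
  shows "phys_L Nx Ny R a b X M U K = generated_average M (advect a c) K"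
  using phys_L_generated[OF assms(1,3,4,5), of a] pairing_advect[OF assms(2,5), of a c]
  by (simp add: generated_average_pairing)

lemma generated_average_add:
  "generated_average M (\<lambda>s r. x *\<^sub>R c s r + y *\<^sub>R c' s r) K =
     x *\<^sub>R generated_average M c K + y *\<^sub>R generated_average M c' K"
  by (simp add: generated_average_pairing pairing_add_coeffs algebra_simps)

lemma phys_step_generated:
  assumes st: "stencil_based Nx Ny S R" and ex: "exact_moments_on Nx Ny X M"
    and step: "phys_step Nx Ny S R a dt X M U U'"
    and gen: "\<And>K. K \<in> cells Nx Ny \<Longrightarrow> U K = generated_average M c K"
  obtains c' where "\<And>z. poly2 c' z = poly2 c (z - dt *\<^sub>R a)"
    "\<And>K. K \<in> cells Nx Ny \<Longrightarrow> U' K = generated_average M c' K"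
proof -
  obtain b0 b1 b2 U1 U2 where ad: "admissible_stage Nx Ny S R X M U b0"
     "admissible_stage Nx Ny S R X M U1 b1" "admissible_stage Nx Ny S R X M U2 b2"
    and U1: "U1 = (\<lambda>K. U K + dt *\<^sub>R phys_L Nx Ny R a b0 X M U K)"
    and U2: "U2 = (\<lambda>K. (3/4) *\<^sub>R U K + (1/4) *\<^sub>R (U1 K + dt *\<^sub>R phys_L Nx Ny R a b1 X M U1 K))"
    and U': "U' = (\<lambda>K. (1/3) *\<^sub>R U K + (2/3) *\<^sub>R (U2 K + dt *\<^sub>R phys_L Nx Ny R a b2 X M U2 K))"
    using step unfolding phys_step_def by blast
  \<comment> \<open>\<open>advect a\<close> is nilpotent of order 3 on quadratics, so the third-order Runge--Kutta method
    reproduces its exponential, the exact translation.\<close>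
  define euler where "euler c = (\<lambda>s r. 1 *\<^sub>R c s r + dt *\<^sub>R advect a c s r)" for c :: "nat \<Rightarrow> nat \<Rightarrow> real^'a"
  define c1 where "c1 = euler c"
  define c2 where "c2 = (\<lambda>s r. (3/4) *\<^sub>R c s r + (1/4) *\<^sub>R euler c1 s r)"
  define c3 where "c3 = (\<lambda>s r. (1/3) *\<^sub>R c s r + (2/3) *\<^sub>R euler c2 s r)"
  have g1: "U1 K = generated_average M c1 K" if "K \<in> cells Nx Ny" for K
    \<comment> \<open>\<open>scaleR_one\<close> is held back so that the factor 1 in
      \<open>euler\<close> survives until \<open>generated_average_add\<close> has matched.\<close>
    using that by (simp add: U1 c1_def euler_def generated_average_add gen phys_stage[OF st ex ad(1) gen] del: scaleR_one)
      simp
  have g2: "U2 K = generated_average M c2 K" if "K \<in> cells Nx Ny" for K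
    using that unfolding U2 c2_def euler_def generated_average_add
    by (simp add: gen g1 phys_stage[OF st ex ad(2) g1])
  have g3: "U' K = generated_average M c3 K" if "K \<in> cells Nx Ny" for K
    using that unfolding U' c3_def euler_def generated_average_add
    by (simp add: gen g2 phys_stage[OF st ex ad(3) g2])
  have "poly2 c3 z = poly2 c (z - dt *\<^sub>R a)" for z
    unfolding poly2_def sum_degree_le_2 c3_def c2_def c1_def euler_def
    by (simp add: vec_eq_iff advect_def numeral_2_eq_2 field_simps)
  then show ?thesis using that g3 by blast
qed

section \<open>Remapping steps and passes\<close>

lemma exact_moments_on_motion:
  assumes ex: "exact_moments_on Nx Ny X M"
    and reg: "\<And>K. K \<in> cells Nx Ny \<Longrightarrow> regular_cell (\<lambda>P. X P + d *\<^sub>R w P) K"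
    and M': "\<And>s r K. M' s r K = M s r K + d * (remap_LM w X s r K
       + 4 * remap_LM w (\<lambda>P. X P + (d/2) *\<^sub>R w P) s r K + remap_LM w (\<lambda>P. X P + d *\<^sub>R w P) s r K) / 6"
  shows "exact_moments_on Nx Ny (\<lambda>P. X P + d *\<^sub>R w P) M'"
  unfolding exact_moments_on_def
proof (intro ballI conjI allI impI)
  fix K s r assume K: "K \<in> cells Nx Ny" and sr: "s + r \<le> (2::nat)"
  have "M s r K = remap_LM X X s r K / real (s + r + 2)"
    using ex K sr exact_moment_eq_remap_LM by (simp add: exact_moments_on_def)
  then show "M' s r K = exact_moment (\<lambda>P. X P + d *\<^sub>R w P) s r K"
    unfolding M' exact_moment_eq_remap_LM[OF reg[OF K] sr]
    using remap_LM_motion[OF sr, of X d w K] by (simp add: field_simps)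
qed (rule reg)

text \<open>In the intermediate stages \<open>M1\<close>, \<open>M2\<close> need not be exact moments; all that matters there is that
  \<open>V\<close> and \<open>M\<close> are advanced by the same quadrature, which keeps \<open>V\<close> the combination of \<open>M\<close> with the
  fixed coefficients \<open>c\<close>. Only the full step, which amounts to Simpson's rule in pseudo-time,
  restores exactness.\<close>

lemma remap_step_generated:
  assumes st: "stencil_based Nx Ny S R"
    and step: "remap_step Nx Ny S R w Y t d M V M' V'"
    and Y: "\<And>x P. Y (t + x) P = Y t P + x *\<^sub>R w P"
    and reg: "\<And>K. K \<in> cells Nx Ny \<Longrightarrow> regular_cell (Y (t + d)) K"
    and ex: "exact_moments_on Nx Ny (Y t) M"
    and V: "\<And>K. K \<in> cells Nx Ny \<Longrightarrow> V K = pairing M c K"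
  shows "exact_moments_on Nx Ny (Y (t + d)) M'"
    and "\<And>K. K \<in> cells Nx Ny \<Longrightarrow> V' K = pairing M' c K"
proof -
  obtain b0 b1 b2 M1 V1 M2 V2 where
     ad: "admissible_stage Nx Ny S R (Y t) M (averages_of M V) b0"
     "admissible_stage Nx Ny S R (Y (t + d)) M1 (averages_of M1 V1) b1"
     "admissible_stage Nx Ny S R (Y (t + d / 2)) M2 (averages_of M2 V2) b2"
    and M1: "M1 = (\<lambda>s r K. M s r K + d * remap_LM w (Y t) s r K)"
    and V1: "V1 = (\<lambda>K. V K + d *\<^sub>R remap_LV Nx Ny R w b0 (Y t) M V K)"
    and M2: "M2 = (\<lambda>s r K. 3/4 * M s r K + 1/4 * (M1 s r K + d * remap_LM w (Y (t + d)) s r K))"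
    and V2: "V2 = (\<lambda>K. (3/4) *\<^sub>R V K
            + (1/4) *\<^sub>R (V1 K + d *\<^sub>R remap_LV Nx Ny R w b1 (Y (t + d)) M1 V1 K))"
    and M': "M' = (\<lambda>s r K. 1/3 * M s r K + 2/3 * (M2 s r K + d * remap_LM w (Y (t + d / 2)) s r K))"
    and V': "V' = (\<lambda>K. (1/3) *\<^sub>R V K
            + (2/3) *\<^sub>R (V2 K + d *\<^sub>R remap_LV Nx Ny R w b2 (Y (t + d / 2)) M2 V2 K))"
    using step unfolding remap_step_def by blast
  have Yx: "Y (t + x) = (\<lambda>P. Y t P + x *\<^sub>R w P)" for x
    using Y by blast
  show "exact_moments_on Nx Ny (Y (t + d)) M'"
    unfolding Yx
  proof (rule exact_moments_on_motion[OF ex])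
    show "regular_cell (\<lambda>P. Y t P + d *\<^sub>R w P) K" if "K \<in> cells Nx Ny" for K
      using reg[OF that] by (simp only: Yx)
  \<comment> \<open>Composing the stages gives the increments at the start, midpoint and end the
    Simpson weights 1/6, 2/3, 1/6.\<close>
  qed (simp add: M' M2 M1 Yx add_divide_distrib distrib_left)
  have euler: "pairing (\<lambda>s r K. N s r K + d * L s r K) c K = pairing N c K + d *\<^sub>R pairing L c K" for N L K
    using pairing_add_moments[of 1 N d L c K] by simp
  have g1: "V1 K = pairing M1 c K" if "K \<in> cells Nx Ny" for K
    using that by (simp add: V1 M1 euler V remap_LV_generated[OF st ad(1) V])
  have g2: "V2 K = pairing M2 c K" if "K \<in> cells Nx Ny" for K
    using that by (simp only: V2 M2 euler pairing_add_moments V g1 remap_LV_generated[OF st ad(2) g1])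
  show "V' K = pairing M' c K" if "K \<in> cells Nx Ny" for K
    using that by (simp only: V' M' euler pairing_add_moments V g2 remap_LV_generated[OF st ad(3) g2])
qed

text \<open>Nonnegativity of the pseudo-time is carried along to place the next mesh in the interval
  where the motion is regular.\<close>

lemma remap_run_generated:
  assumes st: "stencil_based Nx Ny S R" and reg: "regular_motion Nx Ny X X' \<tau>f"
    and run: "remap_run Nx Ny S R (vertex_velocity X X' \<tau>f) (moving_mesh X X' \<tau>f) \<tau>f M V \<tau> M' V'"
    and ex: "exact_moments_on Nx Ny X M"
    and V: "\<And>K. K \<in> cells Nx Ny \<Longrightarrow> V K = pairing M c K"
  shows "0 \<le> \<tau> \<and> exact_moments_on Nx Ny (moving_mesh X X' \<tau>f \<tau>) M' \<and>
    (\<forall>K\<in>cells Nx Ny. V' K = pairing M' c K)"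
  using run
proof induction
  case start
  have "moving_mesh X X' \<tau>f 0 = X" by (simp add: moving_mesh_def fun_eq_iff)
  then show ?case using ex V by simp
next
  case (step \<tau> M1 V1 d M2 V2)
  have Y: "moving_mesh X X' \<tau>f (\<tau> + x) P = moving_mesh X X' \<tau>f \<tau> P + x *\<^sub>R vertex_velocity X X' \<tau>f P" for x P
    by (simp add: moving_mesh_def algebra_simps)
  have "\<tau> + d \<in> {0..\<tau>f}" using step by auto
  then have reg': "regular_cell (moving_mesh X X' \<tau>f (\<tau> + d)) K" if "K \<in> cells Nx Ny" for K
    using reg that by (auto simp: regular_motion_def)
  show ?case
    using remap_step_generated[OF st step.hyps(4) Y reg', of c] step by auto
qed

lemma rezone_remap_generated:
  assumes st: "stencil_based Nx Ny S R"
    and step: "rezone_remap Nx Ny S R (X, M, U) (X', M', U')"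
    and ex: "exact_moments_on Nx Ny X M"
    and ne: "\<forall>K\<in>cells Nx Ny. M 0 0 K \<noteq> 0"
    and U: "\<forall>K\<in>cells Nx Ny. U K = generated_average M c K"
  shows "exact_moments_on Nx Ny X' M' \<and> (\<forall>K\<in>cells Nx Ny. M' 0 0 K \<noteq> 0) \<and>
    (\<forall>K\<in>cells Nx Ny. U' K = generated_average M' c K)"
proof -
  obtain \<tau>f V' where pos: "\<tau>f > 0" and reg: "regular_motion Nx Ny X X' \<tau>f"
    and run: "remap_run Nx Ny S R (vertex_velocity X X' \<tau>f) (moving_mesh X X' \<tau>f) \<tau>f
       M (\<lambda>K. M 0 0 K *\<^sub>R U K) \<tau>f M' V'"
    and ne': "\<forall>K\<in>cells Nx Ny. M' 0 0 K \<noteq> 0" and U': "U' = averages_of M' V'"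
    using step by (auto simp: rezone_remap_def)
  have X': "moving_mesh X X' \<tau>f \<tau>f = X'"
    using pos by (simp add: moving_mesh_def vertex_velocity_def fun_eq_iff)
  \<comment> \<open>The nonzero \<open>M 0 0 K\<close> undoes the division in the average.\<close>
  have "M 0 0 K *\<^sub>R U K = pairing M c K" if "K \<in> cells Nx Ny" for K
    using that ne U by (simp add: generated_average_pairing)
  from remap_run_generated[OF st reg run ex this] show ?thesis
    using ne' by (simp add: X' U' averages_of_def generated_average_pairing)
qed

lemma rezone_remap_tranclp_generated:
  assumes st: "stencil_based Nx Ny S R"
    and "(rezone_remap Nx Ny S R)\<^sup>+\<^sup>+ (X, M, U) (X', M', U')"
    and "exact_moments_on Nx Ny X M" "\<forall>K\<in>cells Nx Ny. M 0 0 K \<noteq> 0"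
    and "\<forall>K\<in>cells Nx Ny. U K = generated_average M c K"
  shows "exact_moments_on Nx Ny X' M' \<and> (\<forall>K\<in>cells Nx Ny. M' 0 0 K \<noteq> 0) \<and>
    (\<forall>K\<in>cells Nx Ny. U' K = generated_average M' c K)"
  using assms(2)
proof (induction "(X', M', U')" arbitrary: X' M' U' rule: tranclp_induct)
  case base
  then show ?case using rezone_remap_generated[OF st] assms(3-5) by blast
next
  case (step Z)
  then show ?case
    using rezone_remap_generated[OF st] by (cases Z) blast
qed

section \<open>Initial data and induction over time steps\<close>

lemma exact_average_poly2:
  "exact_average X (poly2 c) K = generated_average (exact_moment X) c K"
proof -
  have comp: "compact (cell_region X K)"
    by (simp add: cell_region_def finite_imp_compact_convex_hull)
  have "((\<lambda>z. ((z $ 1) ^ s * (z $ 2) ^ r) *\<^sub>R c s r) has_integral exact_moment X s r K *\<^sub>R c s r)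
      (cell_region X K)" for s r
    unfolding exact_moment_def
    by (intro has_integral_scaleR_left integrable_integral set_lebesgue_integral_eq_integral(1)
      integrable_continuous_compact comp continuous_intros)
  then have "(poly2 c has_integral pairing (exact_moment X) c K) (cell_region X K)"
    unfolding poly2_def[abs_def] pairing_def sum_degree_le_2 by (intro has_integral_add)
  moreover have "measure lebesgue (cell_region X K) = exact_moment X 0 0 K"
    using lmeasurable_compact[OF comp] by (simp add: exact_moment_def lmeasure_integral)
  ultimately show ?thesis
    by (simp add: exact_average_def generated_average_pairing integral_unique)
qed

lemma regular_cell_uniform_rectangular:
  assumes "uniform_rectangular Nx Ny X" "K \<in> cells Nx Ny"
  shows "regular_cell X K"
proof -
  \<comment> \<open>Cell indices start at 1; writing them as successors resolves the subtractions in
    \<open>corner\<close>.\<close>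
  obtain i j where K: "K = (Suc i, Suc j)" "Suc i \<le> Nx" "Suc j \<le> Ny"
    using assms(2) by (cases K; cases "fst K"; cases "snd K") (auto simp: cells_def)
  obtain x0 y0 hx hy where h: "hx > 0" "hy > 0"
    and X: "\<And>i j. i \<le> Nx \<Longrightarrow> j \<le> Ny \<Longrightarrow> X (i, j) = vector [x0 + real i * hx, y0 + real j * hy]"
    using assms(1) by (auto simp: uniform_rectangular_def)
  have "corner X K 1 = vector [x0 + real i * hx, y0 + real j * hy]"
    "corner X K 2 = vector [x0 + real i * hx + hx, y0 + real j * hy]"
    "corner X K 3 = vector [x0 + real i * hx + hx, y0 + real j * hy + hy]"
    "corner X K 4 = vector [x0 + real i * hx, y0 + real j * hy + hy]"
    using K by (simp_all add: corner_def X algebra_simps)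
  then show ?thesis
    using h by (auto simp: regular_cell_def strictly_ccw_def vec_eq_iff forall_2)
qed

text \<open>The physical step translates the polynomial, the remapping keeps its coefficients. The
  polynomial is tracked by its values, since coefficients beyond degree 2 are arbitrary.\<close>

lemma rmm_state_generated:
  assumes st: "stencil_based Nx Ny S R" and U0: "\<And>z. U0 z = poly2 c0 z"
    and "rmm_state Nx Ny S R a U0 n t X M U"
  shows "exact_moments_on Nx Ny X M \<and> (\<exists>c. (\<forall>z. poly2 c z = U0 (z - t *\<^sub>R a)) \<and>
    (\<forall>K\<in>cells Nx Ny. U K = generated_average M c K))"
  using assms(3)
proof induction
  case (init X M U)
  have "U0 = poly2 c0" using U0 by blast
  then have "U K = generated_average M c0 K" if "K \<in> cells Nx Ny" for K
    using init(2,3)[OF that] pairing_cong[of M K "exact_moment X" c0]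
    by (simp add: exact_average_poly2 generated_average_pairing)
  moreover have "exact_moments_on Nx Ny X M"
    using init regular_cell_uniform_rectangular by (auto simp: exact_moments_on_def)
  ultimately show ?case
    using U0 by (intro conjI exI[of _ c0]) auto
next
  case (step n t X M U dt U' X'' M'' U'')
  then obtain c where ex: "exact_moments_on Nx Ny X M" and c: "\<And>z. poly2 c z = U0 (z - t *\<^sub>R a)"
    and U: "\<And>K. K \<in> cells Nx Ny \<Longrightarrow> U K = generated_average M c K"
    by blast
  obtain c' where c': "\<And>z. poly2 c' z = poly2 c (z - dt *\<^sub>R a)"
    and U': "\<And>K. K \<in> cells Nx Ny \<Longrightarrow> U' K = generated_average M c' K"
    using phys_step_generated[OF st ex step.hyps(3) U] by blast
  \<comment> \<open>Admissibility of the first physical stage provides this, as that step leaves the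
    moments alone.\<close>
  have "\<forall>K\<in>cells Nx Ny. M 0 0 K \<noteq> 0"
    using step.hyps(3) by (auto simp: phys_step_def admissible_stage_def)
  then have "exact_moments_on Nx Ny X'' M'' \<and> (\<forall>K\<in>cells Nx Ny. U'' K = generated_average M'' c' K)"
    using rezone_remap_tranclp_generated[OF st step.hyps(4) ex] U' by blast
  moreover have "poly2 c' z = U0 (z - (t + dt) *\<^sub>R a)" for z
    by (simp add: c' c algebra_simps)
  ultimately show ?case by blast
qed

theorem theorem4p6:
  fixes Nx Ny n :: nat
    and S :: "cell_idx \<Rightarrow> cell_idx set"
    and R :: "'m::finite reconstruction"
    and a :: "real^2"
    and U0 :: "real^2 \<Rightarrow> real^'m"
    and t :: real
    and X :: mesh
    and M :: egm
    and U :: "'m averages"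
    and K :: cell_idx
  assumes "Nx \<ge> 1" and "Ny \<ge> 1"
    and "stencil_based Nx Ny S R"
    and "\<exists>c. \<forall>z. U0 z = poly2 c z"
    and "rmm_state Nx Ny S R a U0 n t X M U"
    and "K \<in> cells Nx Ny"
  shows "U K = (1 / measure lebesgue (cell_region X K)) *\<^sub>R
           integral (cell_region X K) (\<lambda>x. U0 (x - t *\<^sub>R a))"
proof -
  obtain c0 where "\<And>z. U0 z = poly2 c0 z"
    using assms(4) by blast
  from rmm_state_generated[OF assms(3) this assms(5)] obtain c
    where ex: "exact_moments_on Nx Ny X M" and c: "poly2 c = (\<lambda>z. U0 (z - t *\<^sub>R a))"
      and "U K = generated_average M c K"
    using assms(6) by blast
  \<comment> \<open>Only moments of degree at most 2 enter the average, and there the evolved and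
    exact ones agree.\<close>
  then have "U K = generated_average (exact_moment X) c K"
    using assms(6) pairing_cong[of M K "exact_moment X" c]
    by (simp add: exact_moments_on_def generated_average_pairing)
  also have "\<dots> = exact_average X (poly2 c) K"
    by (simp only: exact_average_poly2)
  finally show ?thesis
    by (simp add: exact_average_def c)
qed

end
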